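(* Let $m\ge2$ and let $\tau=\tau_{m-2}$ or $\tau=\widetilde\tau_{m-2}$. For any $\omega\in\mathcal{M}_m$, the cochains $$gv_\omega(a^0,a^1,a^2)=\tau(a^0(\omega a^1-a^1\omega),a^2),\qquad tgv_\omega(a^0,a^1)=-\tau(a^0,\omega a^1),\qquad a^0,a^1,a^2\in\mathcal{A},$$ in $C^2(\mathcal{A},W_{m-2})$ and $C^1(\mathcal{A},W_{m-2})$ respectively, satisfy $$gv_\omega=b(tgv_\omega)\qquad\text{and}\qquad B(tgv_\omega)=0.$$
   Context: **The algebra $\mathcal{A}$.** $\mathcal{M}=\bigoplus_k\mathcal{M}_k$ is the graded algebra of holomorphic modular forms of all levels, $\mathcal{M}_k=\bigcup_N\mathcal{M}_k(\Gamma(N))$; $w$ denotes weight. $(f|\gamma)(z)=\det(\gamma)^{k/2}(cz+d)^{-k}f(\gamma z)$ for $f$ of weight $k$, $\gamma\in\mathrm{GL}^+(2,\mathbb{Q})$. $\mathcal{A}=\mathcal{M}\ltimes\mathrm{GL}^+(2,\mathbb{Q})$: finite sums $\sum f_\gamma U_\gamma$, product $(fU_\alpha)(gU_\beta)=f\cdot(g|\alpha^{-1})U_{\alpha\beta}$; $\mathcal{M}\subset\mathcal{A}$ via $f\mapsto fU_1$. **Cochains with coefficients.** $W_n$ is the space of homogeneous polynomials of degree $n$ in $\mathbb{C}[T_1,T_2]$ with action $(g\cdot P)(T_1,T_2)=\det(g)^{-n/2}P(aT_1+cT_2,bT_1+dT_2)$, $g=\begin{pmatrix}a&b\\c&d\end{pmatrix}\in\mathrm{GL}^+(2,\mathbb{R})$.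 For a $\mathrm{GL}^+(2,\mathbb{Q})$-module $W$, $C^n(\mathcal{A},W)$ is the space of linear $\phi:\mathcal{A}^{\otimes n+1}\to W$ vanishing on $(f^0U_{\gamma_0},\dots,f^nU_{\gamma_n})$ unless $\gamma_0\cdots\gamma_n=1$. For $a^i=f^iU_{\gamma_i}$, $$(b\phi)(a^0,\dots,a^{n+1})=\sum_{i=0}^n(-1)^i\phi(\dots,a^ia^{i+1},\dots)+(-1)^{n+1}\gamma_{n+1}^{-1}\cdot\phi(a^{n+1}a^0,a^1,\dots,a^n),$$ $(\lambda\phi)(a^0,\dots,a^n)=(-1)^n\gamma_n^{-1}\cdot\phi(a^n,a^0,\dots,a^{n-1})$, and $B=NB_0$ with $(B_0\phi)(a^0,\dots,a^{n-1})=\phi(1,a^0,\dots,a^{n-1})-(-1)^n\phi(a^0,\dots,a^{n-1},1)$, $N=1+\lambda+\dots+\lambda^{n-1}$. **The maps $\tau$.** Put $F(z)=(zT_1+T_2)^{m-2}$ and $\check F(z_0)=\int_0^{z_0}F(z)dz$. For a modular form $f$ of level $N$, $f=\sum_{n\ge0}a_ne^{2\pi inz/N}$, let $\mathbf{a}_0(f)=a_0$, $\widetilde f=f-a_0$. Fix $z_0\in\mathbb{H}$. The bilinear maps $\tau_{m-2},\widetilde\tau_{m-2}:\mathcal{A}\times\mathcal{A}\to W_{m-2}$ vanish on $(f^0U_{\gamma_0},f^1U_{\gamma_1})$ unless $w(f^0)+w(f^1)=m$ and $\gamma_0\gamma_1=1$, in which case, with $g=f^0\cdot(f^1|\gamma_1)$,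 $$\tau_{m-2}(f^0U_{\gamma_0},f^1U_{\gamma_1})=\int_{z_0}^{\gamma_0z_0}F\,g\,dz,$$ $$\widetilde\tau_{m-2}(f^0U_{\gamma_0},f^1U_{\gamma_1})=\int_{z_0}^{\gamma_0z_0}F\,g\,dz+\check F(z_0)\mathbf{a}_0(g)-\gamma_0\cdot\check F(z_0)\,\mathbf{a}_0(g|\gamma_0)-\int_{z_0}^{i\infty}F\,\widetilde g\,dz+\int_{z_0}^{i\infty}\gamma_0\cdot F\;\widetilde{g|\gamma_0}\,dz.$$ *)

theory Defs
  imports
    "HOL-Complex_Analysis.Complex_Analysis"
    "HOL-Number_Theory.Cong"
    "HOL-Library.Function_Algebras"
begin

section \<open>Modular forms of all levels\<close>

definition GL2Q_pos :: "(rat^2^2) set" where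
  "GL2Q_pos = {\<gamma>. det \<gamma> > 0}"

definition Gamma_level :: "nat \<Rightarrow> (rat^2^2) set" where
  "Gamma_level N = (\<lambda>A. \<chi> i j. of_int (A $ i $ j)) `
     {A :: int^2^2. det A = 1 \<and> (\<forall>i j. [A $ i $ j = mat 1 $ i $ j] (mod int N))}"

abbreviation SL2Z :: "(rat^2^2) set" where
  "SL2Z \<equiv> Gamma_level 1"

definition cocyc :: "rat^2^2 \<Rightarrow> complex \<Rightarrow> complex" where
  "cocyc \<gamma> z = of_rat (\<gamma> $ 2 $ 1) * z + of_rat (\<gamma> $ 2 $ 2)"

definition moeb :: "rat^2^2 \<Rightarrow> complex \<Rightarrow> complex" where
  "moeb \<gamma> z = (of_rat (\<gamma> $ 1 $ 1) * z + of_rat (\<gamma> $ 1 $ 2)) / cocyc \<gamma> z"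

definition slash :: "nat \<Rightarrow> (complex \<Rightarrow> complex) \<Rightarrow> rat^2^2 \<Rightarrow> complex \<Rightarrow> complex" where
  "slash k f \<gamma> z =
     of_real (of_rat (det \<gamma>) powr (real k / 2)) * inverse (cocyc \<gamma> z ^ k) * f (moeb \<gamma> z)"

definition q_expansion :: "nat \<Rightarrow> (complex \<Rightarrow> complex) \<Rightarrow> (nat \<Rightarrow> complex) \<Rightarrow> bool" where
  "q_expansion N f a \<longleftrightarrow>
     (\<forall>z. Im z > 0 \<longrightarrow>
        (\<lambda>n. a n * exp (2 * of_real pi * \<i> * of_nat n * z / of_nat N)) sums f z)"

text \<open>A form is a function on the upper half-plane; it is extended by \<open>0\<close> to \<open>\<complex>\<close>, so that
  equality of forms is equality of functions. \<open>slash\<close> by an element of \<open>GL2Q_pos\<close> respects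
  this convention, because the Moebius action preserves the sign of the imaginary part and
  division by zero yields \<open>0\<close>. Weights are natural numbers, since there are no nonzero
  holomorphic modular forms of negative weight. The last condition is holomorphy at all cusps.\<close>

definition modforms_level :: "nat \<Rightarrow> nat \<Rightarrow> (complex \<Rightarrow> complex) set" where
  "modforms_level k N = {f.
     f holomorphic_on {z. Im z > 0} \<and> (\<forall>z. Im z \<le> 0 \<longrightarrow> f z = 0) \<and>
     (\<forall>\<gamma>\<in>Gamma_level N. slash k f \<gamma> = f) \<and>
     (\<forall>\<gamma>\<in>SL2Z. \<exists>a. q_expansion N (slash k f \<gamma>) a)}"

definition modforms :: "nat \<Rightarrow> (complex \<Rightarrow> complex) set" where
  "modforms k = (\<Union>N\<in>{1..}. modforms_level k N)"

definition modforms_graded :: "(nat \<Rightarrow> complex \<Rightarrow> complex) set" where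
  "modforms_graded = {f. (\<forall>k. f k \<in> modforms k) \<and> finite {k. f k \<noteq> 0}}"

text \<open>The constant term does not depend on the level used for the expansion.\<close>

definition const_term :: "(complex \<Rightarrow> complex) \<Rightarrow> complex" where
  "const_term f = (THE c. \<exists>N\<ge>1. \<exists>a. q_expansion N f a \<and> a 0 = c)"

definition cusp_part :: "(complex \<Rightarrow> complex) \<Rightarrow> complex \<Rightarrow> complex" where
  "cusp_part f z = f z - const_term f"


section \<open>The crossed product\<close>

text \<open>The element \<open>\<Sum>\<^sub>\<gamma> f\<^sub>\<gamma> U\<^sub>\<gamma>\<close> is encoded as the function \<open>a\<close> for which \<open>a \<gamma> k\<close> is the
  weight-\<open>k\<close> component of \<open>f\<^sub>\<gamma>\<close>. Addition and subtraction are pointwise.\<close>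

type_synonym crossed = "rat^2^2 \<Rightarrow> nat \<Rightarrow> complex \<Rightarrow> complex"

definition crossed_supp :: "crossed \<Rightarrow> (rat^2^2) set" where
  "crossed_supp a = {\<gamma>. a \<gamma> \<noteq> 0}"

definition crossed_alg :: "crossed set" where
  "crossed_alg = {a. (\<forall>\<gamma>. a \<gamma> \<in> modforms_graded) \<and>
     finite (crossed_supp a) \<and> crossed_supp a \<subseteq> GL2Q_pos}"

definition crossed_smult :: "complex \<Rightarrow> crossed \<Rightarrow> crossed" where
  "crossed_smult c a = (\<lambda>\<gamma> k z. c * a \<gamma> k z)"

definition crossed_mult :: "crossed \<Rightarrow> crossed \<Rightarrow> crossed" (infixl "\<odot>" 70) where
  "a \<odot> b = (\<lambda>\<gamma> k z.
     \<Sum>(\<alpha>, \<beta>) \<in> {(\<alpha>, \<beta>) \<in> crossed_supp a \<times> crossed_supp b. \<alpha> ** \<beta> = \<gamma>}.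
       \<Sum>(i, j) \<in> {(i, j). i + j = k}. a \<alpha> i z * slash j (b \<beta> j) (matrix_inv \<alpha>) z)"

definition form_embed :: "nat \<Rightarrow> (complex \<Rightarrow> complex) \<Rightarrow> crossed" where
  "form_embed k f = (\<lambda>\<gamma> j. if \<gamma> = mat 1 \<and> j = k then f else 0)"

definition crossed_one :: crossed where
  "crossed_one = form_embed 0 (\<lambda>z. if Im z > 0 then 1 else 0)"

definition crossed_comp :: "rat^2^2 \<Rightarrow> crossed \<Rightarrow> crossed" where
  "crossed_comp \<gamma> a = (\<lambda>\<delta>. if \<delta> = \<gamma> then a \<gamma> else 0)"


section \<open>Cochains with coefficients in homogeneous polynomials\<close>

text \<open>Since \<open>\<complex>\<close> is infinite, polynomials in \<open>T\<^sub>1, T\<^sub>2\<close> are identified with polynomial functions.\<close>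

type_synonym bipoly = "complex \<Rightarrow> complex \<Rightarrow> complex"

definition hom_polys :: "nat \<Rightarrow> bipoly set" where
  "hom_polys r = {P. \<exists>c. P = (\<lambda>T1 T2. \<Sum>i\<le>r. c i * T1 ^ i * T2 ^ (r - i))}"

definition poly_act :: "nat \<Rightarrow> rat^2^2 \<Rightarrow> bipoly \<Rightarrow> bipoly" where
  "poly_act r g P = (\<lambda>T1 T2. of_real (of_rat (det g) powr (- real r / 2)) *
     P (of_rat (g $ 1 $ 1) * T1 + of_rat (g $ 2 $ 1) * T2)
       (of_rat (g $ 1 $ 2) * T1 + of_rat (g $ 2 $ 2) * T2))"

text \<open>An \<open>n\<close>-cochain is given by its values on lists \<open>[a\<^sup>0, \<dots>, a\<^sup>n]\<close> of elements of the algebra;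
  values on other lists are irrelevant.\<close>

type_synonym cochain = "crossed list \<Rightarrow> bipoly"

definition tuples :: "nat \<Rightarrow> crossed list set" where
  "tuples n = {as. length as = n + 1 \<and> set as \<subseteq> crossed_alg}"

definition cochains :: "nat \<Rightarrow> nat \<Rightarrow> cochain set" where
  "cochains r n = {\<phi>.
     (\<forall>as\<in>tuples n. \<phi> as \<in> hom_polys r) \<and>
     (\<forall>as\<in>tuples n. \<forall>i\<le>n. \<forall>x\<in>crossed_alg. \<forall>y\<in>crossed_alg.
        \<phi> (as[i := x + y]) = \<phi> (as[i := x]) + \<phi> (as[i := y])) \<and>
     (\<forall>as\<in>tuples n. \<forall>i\<le>n. \<forall>x\<in>crossed_alg. \<forall>c T1 T2.
        \<phi> (as[i := crossed_smult c x]) T1 T2 = c * \<phi> (as[i := x]) T1 T2) \<and>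
     (\<forall>as\<in>tuples n. \<forall>\<gamma>s. length \<gamma>s = n + 1 \<longrightarrow> set \<gamma>s \<subseteq> GL2Q_pos \<longrightarrow>
        (\<forall>i\<le>n. crossed_supp (as ! i) \<subseteq> {\<gamma>s ! i}) \<longrightarrow>
        foldr (**) \<gamma>s (mat 1) \<noteq> mat 1 \<longrightarrow> \<phi> as = 0)}"

text \<open>The operators \<open>b\<close> and \<open>\<lambda>\<close> are prescribed on homogeneous elements \<open>f U\<^sub>\<gamma>\<close>; the linear
  extension in the last argument is the sum over its components. The parameter \<open>n\<close> of
  \<open>coch_b\<close>, \<open>coch_lam\<close>, \<open>coch_B0\<close> and \<open>coch_B\<close> is the degree of the cochain \<open>\<phi>\<close>
  to which they are applied.\<close>

definition twist_last :: "nat \<Rightarrow> cochain \<Rightarrow> (crossed \<Rightarrow> crossed list) \<Rightarrow> crossed \<Rightarrow> bipoly" where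
  "twist_last r \<phi> args a =
     (\<Sum>\<gamma>\<in>crossed_supp a. poly_act r (matrix_inv \<gamma>) (\<phi> (args (crossed_comp \<gamma> a))))"

definition coch_b :: "nat \<Rightarrow> nat \<Rightarrow> cochain \<Rightarrow> cochain" where
  "coch_b r n \<phi> as = (\<lambda>T1 T2.
     (\<Sum>i\<le>n. (-1) ^ i * \<phi> (take i as @ [as ! i \<odot> as ! (i + 1)] @ drop (i + 2) as) T1 T2) +
     (-1) ^ (n + 1) *
       twist_last r \<phi> (\<lambda>x. (x \<odot> as ! 0) # drop 1 (take (n + 1) as)) (as ! (n + 1)) T1 T2)"

definition coch_lam :: "nat \<Rightarrow> nat \<Rightarrow> cochain \<Rightarrow> cochain" where
  "coch_lam r n \<phi> as = (\<lambda>T1 T2.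
     (-1) ^ n * twist_last r \<phi> (\<lambda>x. x # take n as) (as ! n) T1 T2)"

definition coch_B0 :: "nat \<Rightarrow> cochain \<Rightarrow> cochain" where
  "coch_B0 n \<phi> as = (\<lambda>T1 T2.
     \<phi> (crossed_one # as) T1 T2 - (-1) ^ n * \<phi> (as @ [crossed_one]) T1 T2)"

definition coch_B :: "nat \<Rightarrow> nat \<Rightarrow> cochain \<Rightarrow> cochain" where
  "coch_B r n \<phi> = (\<Sum>j<n. (coch_lam r (n - 1) ^^ j) (coch_B0 n \<phi>))"


section \<open>The period maps\<close>

text \<open>Integrals of polynomial-valued functions are taken pointwise in \<open>(T1, T2)\<close>. Paths between
  points of the upper half-plane are straight segments, and the path from \<open>z0\<close> to \<open>\<i>\<infinity>\<close> is the
  vertical ray; the integrands are holomorphic there.\<close>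

definition F_poly :: "nat \<Rightarrow> complex \<Rightarrow> bipoly" where
  "F_poly m z = (\<lambda>T1 T2. (z * T1 + T2) ^ (m - 2))"

definition F_prim :: "nat \<Rightarrow> complex \<Rightarrow> bipoly" where
  "F_prim m z0 = (\<lambda>T1 T2. contour_integral (linepath 0 z0) (\<lambda>z. F_poly m z T1 T2))"

definition ray_integral :: "complex \<Rightarrow> (complex \<Rightarrow> complex) \<Rightarrow> complex" where
  "ray_integral z0 h = integral {0..} (\<lambda>t::real. h (z0 + \<i> * of_real t) * \<i>)"

definition tau_kernel :: "nat \<Rightarrow> complex \<Rightarrow> rat^2^2 \<Rightarrow> (complex \<Rightarrow> complex) \<Rightarrow> bipoly" where
  "tau_kernel m z0 \<gamma> g = (\<lambda>T1 T2.
     contour_integral (linepath z0 (moeb \<gamma> z0)) (\<lambda>z. F_poly m z T1 T2 * g z))"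

definition ttau_kernel :: "nat \<Rightarrow> complex \<Rightarrow> rat^2^2 \<Rightarrow> (complex \<Rightarrow> complex) \<Rightarrow> bipoly" where
  "ttau_kernel m z0 \<gamma> g = (\<lambda>T1 T2.
     contour_integral (linepath z0 (moeb \<gamma> z0)) (\<lambda>z. F_poly m z T1 T2 * g z)
     + F_prim m z0 T1 T2 * const_term g
     - poly_act (m - 2) \<gamma> (F_prim m z0) T1 T2 * const_term (slash m g \<gamma>)
     - ray_integral z0 (\<lambda>z. F_poly m z T1 T2 * cusp_part g z)
     + ray_integral z0
         (\<lambda>z. poly_act (m - 2) \<gamma> (F_poly m z) T1 T2 * cusp_part (slash m g \<gamma>) z))"

text \<open>The bilinear map on the crossed product determined by a kernel on homogeneous pairs
  \<open>(f\<^sup>0 U\<^bsub>\<gamma>0\<^esub>, f\<^sup>1 U\<^bsub>\<gamma>1\<^esub>)\<close>, with \<open>f\<^sup>0\<close> and \<open>f\<^sup>1\<close> of weights \<open>k0\<close> and \<open>k1\<close>.\<close>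

definition bilin_ext ::
  "nat \<Rightarrow> (rat^2^2 \<Rightarrow> (complex \<Rightarrow> complex) \<Rightarrow> bipoly) \<Rightarrow> crossed \<Rightarrow> crossed \<Rightarrow> bipoly" where
  "bilin_ext m K a b =
     (\<Sum>(\<gamma>0, k0) \<in> {(\<gamma>, k). a \<gamma> k \<noteq> 0}. \<Sum>(\<gamma>1, k1) \<in> {(\<gamma>, k). b \<gamma> k \<noteq> 0}.
        if k0 + k1 = m \<and> \<gamma>0 ** \<gamma>1 = mat 1
        then K \<gamma>0 (a \<gamma>0 k0 * slash k1 (b \<gamma>1 k1) \<gamma>1) else 0)"

definition tau :: "nat \<Rightarrow> complex \<Rightarrow> crossed \<Rightarrow> crossed \<Rightarrow> bipoly" where
  "tau m z0 = bilin_ext m (tau_kernel m z0)"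

definition ttau :: "nat \<Rightarrow> complex \<Rightarrow> crossed \<Rightarrow> crossed \<Rightarrow> bipoly" where
  "ttau m z0 = bilin_ext m (ttau_kernel m z0)"

text \<open>Here \<open>w\<close> is the image in the crossed product of the modular form \<open>\<omega>\<close>.\<close>

definition gv :: "(crossed \<Rightarrow> crossed \<Rightarrow> bipoly) \<Rightarrow> crossed \<Rightarrow> cochain" where
  "gv \<tau> w as = \<tau> (as ! 0 \<odot> (w \<odot> as ! 1 - as ! 1 \<odot> w)) (as ! 2)"

definition tgv :: "(crossed \<Rightarrow> crossed \<Rightarrow> bipoly) \<Rightarrow> crossed \<Rightarrow> cochain" where
  "tgv \<tau> w as = - \<tau> (as ! 0) (w \<odot> as ! 1)"

end

theory Submission
  imports Defs
begin

text \<open>Both bilinear maps arise in the same way from a kernel \<open>K \<gamma> g\<close>, a polynomial depending on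
\<open>\<gamma>\<close> and linearly on a form \<open>g\<close> of weight \<open>m\<close>: on \<open>(f\<^sup>0 U\<^bsub>\<gamma>\<^esub>, f\<^sup>1 U\<^bsub>\<beta>\<^esub>)\<close> with \<open>\<gamma>\<beta> = 1\<close> and total weight
\<open>m\<close>, the value is \<open>K \<gamma> (f\<^sup>0 (f\<^sup>1|\<beta>))\<close>. Everything rests on the cocycle relation
\<open>K (\<delta>\<epsilon>) g = K \<delta> g + \<delta> \<cdot> K \<epsilon> (g|\<delta>)\<close>, isolated in the locale \<open>period_cocycle\<close>.

For the integral from \<open>z0\<close> to \<open>\<gamma> z0\<close> the relation is a change of variables: the differential
\<open>(\<delta> \<cdot> F) (g|\<delta>) dz\<close> is the pullback of \<open>F g dz\<close> along \<open>\<delta>\<close> (\<open>F_poly_slash\<close>). If \<open>P\<close> is a primitive of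
\<open>F g\<close> on the upper half-plane, the three terms are \<open>P(\<delta>\<epsilon>z0) - P(z0)\<close>, \<open>P(\<delta>z0) - P(z0)\<close> and
\<open>P(\<delta>\<epsilon>z0) - P(\<delta>z0)\<close> (\<open>tau_kernel_cocycle\<close>). The second kernel differs from the first by the coboundary
\<open>C(g) - \<gamma> \<cdot> C(g|\<gamma>)\<close> of the polynomial \<open>C = cusp_correction\<close> (\<open>ttau_kernel_eq\<close>), so it satisfies the same relation.

On homogeneous elements the cocycle relation says exactly that the bilinear map \<open>\<tau>\<close> is a twisted
Hochschild cocycle, \<open>\<tau>(bc, d) - \<tau>(b, cd) + \<gamma>\<^sup>-\<^sup>1 \<cdot> \<tau>(db, c) = 0\<close> for \<open>d\<close> supported at \<open>\<gamma>\<close>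
(\<open>pairing_cocycle\<close>). Since forms embedded at \<open>\<gamma> = 1\<close> can be moved across the comma,
\<open>\<tau>(b\<omega>, d) = \<tau>(b, \<omega>d)\<close> (\<open>pairing_move_form\<close>), taking \<open>b = a\<^sup>0\<close>, \<open>c = \<omega>a\<^sup>1\<close>, \<open>d = a\<^sup>2\<close> turns
\<open>\<tau>(a\<^sup>0\<omega>a\<^sup>1, a\<^sup>2) - \<tau>(a\<^sup>0a\<^sup>1\<omega>, a\<^sup>2)\<close> into the three terms of \<open>b(tgv)\<close>. Finally \<open>B(tgv)\<close> involves only
\<open>\<tau>(1, \<omega>a)\<close> and \<open>\<tau>(a, \<omega>)\<close>, hence only \<open>K 1\<close>, which vanishes by the cocycle relation.

Two supporting facts make these formulas meaningful. The union over all levels of the modular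
forms is stable under the slash action of all of \<open>GL2Q_pos\<close> (\<open>modforms_slash\<close>), so that the crossed
product is closed under multiplication. And a modular form minus its constant term decays
exponentially towards \<open>\<i>\<infinity>\<close> (\<open>cusp_part_decay\<close>), so that the ray integrals converge and are linear in
the form.\<close>

(* Power series coefficients use the same infix symbol as matrix entries. *)
no_notation fps_nth (infixl "$" 75)

section \<open>The action on the upper half-plane\<close>

lemma mat_inv_GL2Q:
  assumes "\<gamma> \<in> GL2Q_pos"
  shows mat_inv_right: "\<gamma> ** matrix_inv \<gamma> = mat 1"
    and mat_inv_left: "matrix_inv \<gamma> ** \<gamma> = mat 1"
proof -
  have "invertible \<gamma>"
    using assms by (simp add: GL2Q_pos_def invertible_det_nz)
  then have "\<exists>A'. \<gamma> ** A' = mat 1 \<and> A' ** \<gamma> = mat 1"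
    by (simp add: invertible_def)
  then have "\<gamma> ** matrix_inv \<gamma> = mat 1 \<and> matrix_inv \<gamma> ** \<gamma> = mat 1"
    unfolding matrix_inv_def by (rule someI_ex)
  then show "\<gamma> ** matrix_inv \<gamma> = mat 1" "matrix_inv \<gamma> ** \<gamma> = mat 1"
    by auto
qed

lemma mult_GL2Q: "\<alpha> \<in> GL2Q_pos \<Longrightarrow> \<beta> \<in> GL2Q_pos \<Longrightarrow> \<alpha> ** \<beta> \<in> GL2Q_pos"
  by (simp add: GL2Q_pos_def det_mul)

lemma one_GL2Q: "mat 1 \<in> GL2Q_pos"
  by (simp add: GL2Q_pos_def)

lemma inv_GL2Q:
  assumes "\<gamma> \<in> GL2Q_pos"
  shows "matrix_inv \<gamma> \<in> GL2Q_pos"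
proof -
  have "det \<gamma> * det (matrix_inv \<gamma>) = 1"
    using mat_inv_right[OF assms] by (metis det_I det_mul)
  then show ?thesis
    using assms by (simp add: GL2Q_pos_def) (metis zero_less_mult_pos zero_less_one)
qed

lemma mat_mult_eq_one_iff:
  assumes "\<alpha> \<in> GL2Q_pos"
  shows "\<alpha> ** \<beta> = mat 1 \<longleftrightarrow> \<beta> = matrix_inv \<alpha>"
  using mat_inv_left[OF assms] mat_inv_right[OF assms]
  by (metis matrix_mul_assoc matrix_mul_lid matrix_mul_rid)

lemma mat_inv_one: "matrix_inv (mat 1 :: rat^2^2) = mat 1"
  using mat_mult_eq_one_iff[OF one_GL2Q, of "mat 1"] by simp

lemma mat_inv_mult:
  assumes "\<alpha> \<in> GL2Q_pos" "\<beta> \<in> GL2Q_pos"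
  shows "matrix_inv (\<alpha> ** \<beta>) = matrix_inv \<beta> ** matrix_inv \<alpha>"
proof -
  have "(\<alpha> ** \<beta>) ** (matrix_inv \<beta> ** matrix_inv \<alpha>) = \<alpha> ** (\<beta> ** matrix_inv \<beta>) ** matrix_inv \<alpha>"
    by (simp add: matrix_mul_assoc)
  also have "\<dots> = mat 1"
    by (simp add: assms mat_inv_right)
  finally show ?thesis
    using mat_mult_eq_one_iff[OF mult_GL2Q[OF assms]] by simp
qed

lemma mat_inv_inv: "\<gamma> \<in> GL2Q_pos \<Longrightarrow> matrix_inv (matrix_inv \<gamma>) = \<gamma>"
  using mat_mult_eq_one_iff[OF inv_GL2Q] mat_inv_left by metis

lemma of_rat_complex: "(of_rat r :: complex) = of_real (of_rat r)"
  by (cases r) (simp add: of_rat_rat)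

lemma cocyc_real: "cocyc \<gamma> z = of_real (of_rat (\<gamma> $ 2 $ 1)) * z + of_real (of_rat (\<gamma> $ 2 $ 2))"
  by (simp add: cocyc_def of_rat_complex)

text \<open>A real combination \<open>c z + d\<close> with \<open>z\<close> non-real vanishes only if \<open>c = d = 0\<close>, which the determinant forbids.\<close>

lemma cocyc_nonzero:
  assumes "\<gamma> \<in> GL2Q_pos" "Im z > 0"
  shows "cocyc \<gamma> z \<noteq> 0"
proof
  assume 0: "cocyc \<gamma> z = 0"
  then have "Im (cocyc \<gamma> z) = 0" "Re (cocyc \<gamma> z) = 0"
    by auto
  then have "\<gamma> $ 2 $ 1 = 0" "\<gamma> $ 2 $ 2 = 0"
    using assms(2) by (auto simp: cocyc_real)
  then show False
    using assms(1) by (simp add: GL2Q_pos_def det_2)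
qed

lemma Im_moeb: "Im (moeb \<gamma> z) = of_rat (det \<gamma>) * Im z / (cmod (cocyc \<gamma> z))\<^sup>2"
  by (simp add: moeb_def cocyc_real of_rat_complex Im_divide cmod_power2 det_2 of_rat_diff of_rat_mult
      algebra_simps)

lemma Im_moeb_pos: "\<gamma> \<in> GL2Q_pos \<Longrightarrow> Im z > 0 \<Longrightarrow> Im (moeb \<gamma> z) > 0"
  using cocyc_nonzero[of \<gamma> z] by (simp add: Im_moeb GL2Q_pos_def)

lemma Im_moeb_nonpos: "\<gamma> \<in> GL2Q_pos \<Longrightarrow> Im z \<le> 0 \<Longrightarrow> Im (moeb \<gamma> z) \<le> 0"
  by (simp add: Im_moeb GL2Q_pos_def divide_nonpos_nonneg mult_nonneg_nonpos)

lemma moeb_times_cocyc: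
  assumes "\<gamma> \<in> GL2Q_pos" "Im z > 0"
  shows "moeb \<gamma> z * cocyc \<gamma> z = of_rat (\<gamma> $ 1 $ 1) * z + of_rat (\<gamma> $ 1 $ 2)"
  using cocyc_nonzero[OF assms] by (simp add: moeb_def)

lemma cocyc_mult:
  assumes "\<beta> \<in> GL2Q_pos" "Im z > 0"
  shows "cocyc (\<alpha> ** \<beta>) z = cocyc \<alpha> (moeb \<beta> z) * cocyc \<beta> z"
proof -
  have "cocyc (\<alpha> ** \<beta>) z = of_rat (\<alpha> $ 2 $ 1) * (of_rat (\<beta> $ 1 $ 1) * z + of_rat (\<beta> $ 1 $ 2))
      + of_rat (\<alpha> $ 2 $ 2) * cocyc \<beta> z"
    by (simp add: cocyc_def matrix_matrix_mult_def sum_2 of_rat_add of_rat_mult algebra_simps)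
  then show ?thesis
    unfolding moeb_times_cocyc[OF assms, symmetric] by (simp add: cocyc_def[of \<alpha>] algebra_simps)
qed

lemma moeb_mult:
  assumes "\<alpha> \<in> GL2Q_pos" "\<beta> \<in> GL2Q_pos" "Im z > 0"
  shows "moeb (\<alpha> ** \<beta>) z = moeb \<alpha> (moeb \<beta> z)"
proof -
  have nz: "cocyc \<beta> z \<noteq> 0" "cocyc \<alpha> (moeb \<beta> z) \<noteq> 0"
    using assms by (simp_all add: cocyc_nonzero Im_moeb_pos)
  have "of_rat ((\<alpha> ** \<beta>) $ 1 $ 1) * z + of_rat ((\<alpha> ** \<beta>) $ 1 $ 2)
      = of_rat (\<alpha> $ 1 $ 1) * (of_rat (\<beta> $ 1 $ 1) * z + of_rat (\<beta> $ 1 $ 2))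
        + of_rat (\<alpha> $ 1 $ 2) * cocyc \<beta> z"
    by (simp add: cocyc_def matrix_matrix_mult_def sum_2 of_rat_add of_rat_mult algebra_simps)
  also have "\<dots> = (of_rat (\<alpha> $ 1 $ 1) * moeb \<beta> z + of_rat (\<alpha> $ 1 $ 2)) * cocyc \<beta> z"
    unfolding moeb_times_cocyc[OF assms(2,3), symmetric] by (simp add: algebra_simps)
  finally show ?thesis
    unfolding moeb_def[of "\<alpha> ** \<beta>"] moeb_def[of \<alpha> "moeb \<beta> z"] cocyc_mult[OF assms(2,3)]
    using nz by simp
qed

lemma moeb_one: "moeb (mat 1) z = z"
  by (simp add: moeb_def cocyc_def mat_def)

lemma slash_one: "slash k f (mat 1) = f"
  by (simp add: fun_eq_iff slash_def moeb_one) (simp add: cocyc_def mat_def)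

text \<open>Forms are extended by zero, so that identities between forms are identities of functions. The
cocycle identity for the automorphy factor holds only on the upper half-plane; below it, composition
of slash operators is consistent because all values are zero.\<close>

definition off_H_zero :: "(complex \<Rightarrow> complex) \<Rightarrow> bool" where
  "off_H_zero f \<longleftrightarrow> (\<forall>z. Im z \<le> 0 \<longrightarrow> f z = 0)"

lemma off_H_zero_slash: "\<gamma> \<in> GL2Q_pos \<Longrightarrow> off_H_zero f \<Longrightarrow> off_H_zero (slash k f \<gamma>)"
  by (simp add: off_H_zero_def slash_def Im_moeb_nonpos)

lemma slash_slash:
  assumes "\<alpha> \<in> GL2Q_pos" "\<beta> \<in> GL2Q_pos" "off_H_zero f"
  shows "slash k (slash k f \<alpha>) \<beta> = slash k f (\<alpha> ** \<beta>)"
proof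
  fix z
  show "slash k (slash k f \<alpha>) \<beta> z = slash k f (\<alpha> ** \<beta>) z"
  proof (cases "Im z > 0")
    case True
    have "(of_rat (det \<alpha>) * of_rat (det \<beta>) :: real) powr (real k / 2)
        = of_rat (det \<alpha>) powr (real k / 2) * of_rat (det \<beta>) powr (real k / 2)"
      by (rule powr_mult)
    then show ?thesis
      using assms True
      by (simp add: slash_def cocyc_mult moeb_mult det_mul of_rat_mult power_mult_distrib)
  next
    case False
    then show ?thesis
      using off_H_zero_slash[OF assms(2) off_H_zero_slash[OF assms(1,3)]]
        off_H_zero_slash[OF mult_GL2Q[OF assms(1,2)] assms(3)]
      by (simp add: off_H_zero_def)
  qed
qed

lemma slash_mult: "slash (i + j) (f * g) \<gamma> = slash i f \<gamma> * slash j g \<gamma>"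
  by (auto simp: fun_eq_iff slash_def power_add add_divide_distrib powr_add)

lemma slash_add: "slash k (f + g) \<gamma> = slash k f \<gamma> + slash k g \<gamma>"
  by (auto simp: fun_eq_iff slash_def algebra_simps)

lemma slash_scale: "slash k (\<lambda>z. c * f z) \<gamma> = (\<lambda>z. c * slash k f \<gamma> z)"
  by (auto simp: fun_eq_iff slash_def)

lemma slash_zero: "slash k 0 \<gamma> = 0"
  by (auto simp: fun_eq_iff slash_def)

lemma moeb_has_field_derivative:
  assumes "\<gamma> \<in> GL2Q_pos" "Im z > 0"
  shows "(moeb \<gamma> has_field_derivative of_rat (det \<gamma>) / (cocyc \<gamma> z)\<^sup>2) (at z)"
  using cocyc_nonzero[OF assms] unfolding moeb_def cocyc_def
  by (auto intro!: derivative_eq_intros simp: det_2 of_rat_diff of_rat_mult power2_eq_square field_simps)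

lemma slash_holomorphic:
  assumes "\<gamma> \<in> GL2Q_pos" "f holomorphic_on {z. Im z > 0}"
  shows "slash k f \<gamma> holomorphic_on {z. Im z > 0}"
proof -
  have "moeb \<gamma> holomorphic_on {z. Im z > 0}"
    using moeb_has_field_derivative[OF assms(1)]
    by (auto simp: holomorphic_on_def field_differentiable_def intro: has_field_derivative_at_within)
  then have "(\<lambda>z. f (moeb \<gamma> z)) holomorphic_on {z. Im z > 0}"
    using holomorphic_on_compose_gen[OF _ assms(2)] Im_moeb_pos[OF assms(1)] by (force simp: o_def)
  moreover have "cocyc \<gamma> holomorphic_on {z. Im z > 0}"
    unfolding cocyc_def by (intro holomorphic_intros)
  ultimately show ?thesis
    unfolding slash_def
    by (intro holomorphic_intros) (auto simp: cocyc_nonzero[OF assms(1)])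
qed

section \<open>Fourier expansions at infinity\<close>

text \<open>A Fourier expansion is a power series in the local parameter \<open>q = exp (2\<pi>\<i>z/N)\<close>; the analysis below is that of power series.\<close>

lemma q_expansion_iff_powers:
  "q_expansion N f a \<longleftrightarrow>
     (\<forall>z. Im z > 0 \<longrightarrow> (\<lambda>n. a n * exp (2 * of_real pi * \<i> * z / of_nat N) ^ n) sums f z)"
  unfolding q_expansion_def by (simp add: exp_of_nat_mult[symmetric] mult_ac)

lemma norm_exp_cusp: "norm (exp (2 * of_real pi * \<i> * z / of_nat N)) = exp (- 2 * pi * Im z / real N)"
  by (simp add: norm_exp_eq_Re)

text \<open>Convergence at a point with half the imaginary part, where \<open>\<bar>q\<bar>\<close> is larger, gives absolute convergence.\<close>

lemma q_expansion_abs_summable: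
  assumes "q_expansion N f a" "N \<ge> 1" "Im z > 0"
  shows "summable (\<lambda>n. norm (a n * exp (2 * of_real pi * \<i> * z / of_nat N) ^ n))"
proof (rule powser_insidea)
  (* A comparison point with a larger local parameter. *)
  define w where "w = \<i> * of_real (Im z / 2)"
  have w: "Im w = Im z / 2"
    by (simp add: w_def)
  then have "Im w > 0"
    using assms by simp
  then show "summable (\<lambda>n. a n * exp (2 * of_real pi * \<i> * w / of_nat N) ^ n)"
    using assms(1) unfolding q_expansion_iff_powers by (blast intro: sums_summable)
  show "norm (exp (2 * of_real pi * \<i> * z / of_nat N)) < norm (exp (2 * of_real pi * \<i> * w / of_nat N))"
    unfolding norm_exp_cusp w using assms by (simp add: field_simps)
qed

text \<open>All terms of positive index are divisible by \<open>q\<close>; above height \<open>y\<close> the quotient by \<open>q\<close> is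
dominated termwise by the absolutely convergent series at height \<open>y\<close>, and \<open>\<bar>q\<bar>\<close> decays exponentially with the height.\<close>

lemma q_expansion_decay:
  assumes "q_expansion N f a" "N \<ge> 1" "y > 0"
  shows "\<exists>C. \<forall>z. Im z \<ge> y \<longrightarrow> norm (f z - a 0) \<le> C * exp (- 2 * pi * Im z / real N)"
proof -
  define q where "q = (\<lambda>z. exp (2 * of_real pi * \<i> * z / of_nat N))"
  define r where "r = exp (- 2 * pi * y / real N)"
  have q_norm: "norm (q z) = exp (- 2 * pi * Im z / real N)" for z
    unfolding q_def by (rule norm_exp_cusp)
  have "summable (\<lambda>n. norm (a n) * r ^ n)"
    using q_expansion_abs_summable[OF assms(1,2), of "\<i> * of_real y"] assms(3)
      q_norm[of "\<i> * of_real y"]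
    by (simp add: q_def r_def norm_mult norm_power)
  then have sum_r: "summable (\<lambda>n. norm (a (Suc n)) * r ^ Suc n)"
    by (subst summable_Suc_iff)
  define C where "C = (\<Sum>n. norm (a (Suc n)) * r ^ Suc n) / r"
  have "norm (f z - a 0) \<le> C * exp (- 2 * pi * Im z / real N)" if "Im z \<ge> y" for z
  proof -
    have z: "Im z > 0"
      using that assms(3) by simp
    have "(\<lambda>n. a n * q z ^ n) sums f z"
      using assms(1) z by (simp add: q_expansion_iff_powers q_def)
    then have tail: "(\<lambda>n. a (Suc n) * q z ^ Suc n) sums (f z - a 0)"
      by (subst sums_Suc_iff) simp
    have qr: "norm (q z) \<le> r"
      unfolding q_norm r_def using that assms(2) by (simp add: divide_right_mono)
    have le: "norm (a (Suc n) * q z ^ Suc n) \<le> norm (a (Suc n)) * r ^ Suc n * (norm (q z) / r)" for n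
    proof -
      have "norm (q z) ^ n \<le> r ^ n"
        using qr by (simp add: power_mono)
      then have "norm (a (Suc n)) * norm (q z) * norm (q z) ^ n \<le> norm (a (Suc n)) * norm (q z) * r ^ n"
        by (intro mult_left_mono) auto
      then show ?thesis
        by (simp add: norm_mult norm_power r_def mult_ac)
    qed
    have "summable (\<lambda>n. norm (a (Suc n)) * r ^ Suc n * (norm (q z) / r))"
      by (rule summable_mult2[OF sum_r])
    then have "norm (f z - a 0) \<le> (\<Sum>n. norm (a (Suc n)) * r ^ Suc n * (norm (q z) / r))"
      unfolding sums_unique[OF tail] using le by (intro norm_suminf_le)
    also have "\<dots> = C * norm (q z)"
      using suminf_mult2[OF sum_r, of "norm (q z) / r"] by (simp add: C_def)
    finally show ?thesis
      unfolding q_norm .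
  qed
  then show ?thesis
    by blast
qed

text \<open>The zeroth coefficient is the limit of the function along the imaginary axis, whatever the level of
the expansion; this is why the description defining \<^const>\<open>const_term\<close> determines a unique number.\<close>

lemma const_term_eq:
  assumes "q_expansion N f a" "N \<ge> 1"
  shows "const_term f = a 0"
proof -
  have lim: "((\<lambda>t::real. f (\<i> * of_real t)) \<longlongrightarrow> b 0) at_top" if b: "q_expansion M f b" "M \<ge> 1" for M b
  proof -
    obtain C where C: "\<And>z. Im z \<ge> 1 \<Longrightarrow> norm (f z - b 0) \<le> C * exp (- 2 * pi * Im z / real M)"
      using q_expansion_decay[OF b, of 1] by auto
    have "((\<lambda>t::real. C * exp (- 2 * pi * t / real M)) \<longlongrightarrow> 0) at_top"
      using b(2) by real_asymp
    moreover have "\<forall>\<^sub>F t in at_top. norm (f (\<i> * of_real t) - b 0) \<le> C * exp (- 2 * pi * t / real M)"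
      using eventually_ge_at_top[of 1]
    proof eventually_elim
      case (elim t)
      then show ?case
        using C[of "\<i> * of_real t"] by simp
    qed
    ultimately have "((\<lambda>t::real. f (\<i> * of_real t) - b 0) \<longlongrightarrow> 0) at_top"
      by (rule Lim_null_comparison[rotated])
    then show ?thesis
      by (simp add: LIM_zero_iff)
  qed
  show ?thesis
    unfolding const_term_def
  proof (rule the_equality)
    show "\<exists>N\<ge>1. \<exists>b. q_expansion N f b \<and> b 0 = a 0"
      using assms by blast
    show "c = a 0" if "\<exists>N\<ge>1. \<exists>b. q_expansion N f b \<and> b 0 = c" for c
      using that lim lim[OF assms] tendsto_unique[OF trivial_limit_at_top_linorder] by metis
  qed
qed

text \<open>The substitution by an upper triangular matrix: with \<open>w = (A z + B) / D\<close>, the \<open>n\<close>-th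
exponential at level \<open>N\<close> becomes a constant times the \<open>n A t\<close>-th exponential at level \<open>N D t\<close>. The
free factor \<open>t\<close> serves to reach a prescribed common level.\<close>

lemma q_expansion_affine:
  assumes "q_expansion N f a" "N \<ge> 1" "A \<ge> 1" "D \<ge> 1" "t \<ge> 1"
    and h: "\<And>z. Im z > 0 \<Longrightarrow> h z = c * f ((of_nat A * z + of_int B) / of_nat D)"
  shows "\<exists>a'. q_expansion (N * D * t) h a'"
proof -
  define s where "s = A * t"
  have s: "s \<ge> 1"
    using assms by (simp add: s_def)
  (* The translation by B only rotates the coefficients. *)
  define e where "e = (\<lambda>n. exp (2 * of_real pi * \<i> * of_nat n * of_int B / (of_nat D * of_nat N)))"
  define a' where "a' = (\<lambda>n. if s dvd n then c * (a (n div s) * e (n div s)) else 0)"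
  have "(\<lambda>n. a' n * exp (2 * of_real pi * \<i> * of_nat n * z / of_nat (N * D * t))) sums h z"
    if z: "Im z > 0" for z
  proof -
    define w where "w = (of_nat A * z + of_int B) / of_nat D"
    have "Im w > 0"
      using z assms by (simp add: w_def Im_divide_of_nat)
    then have "(\<lambda>n. a n * exp (2 * of_real pi * \<i> * of_nat n * w / of_nat N)) sums f w"
      using assms(1) by (simp add: q_expansion_def)
    then have "(\<lambda>n. c * (a n * exp (2 * of_real pi * \<i> * of_nat n * w / of_nat N))) sums h z"
      unfolding h[OF z] w_def[symmetric] by (rule sums_mult)
    moreover have "exp (2 * of_real pi * \<i> * of_nat n * w / of_nat N)
        = e n * exp (2 * of_real pi * \<i> * of_nat (n * s) * z / of_nat (N * D * t))" for n
      unfolding e_def exp_add[symmetric] using assms by (simp add: w_def s_def field_simps)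
    ultimately have "(\<lambda>n. a' (n * s) * exp (2 * of_real pi * \<i> * of_nat (n * s) * z / of_nat (N * D * t)))
        sums h z"
      using s by (simp add: a'_def mult.assoc)
    moreover have "strict_mono (\<lambda>n. n * s)"
      using s by (simp add: strict_mono_def)
    moreover have "a' n * exp (2 * of_real pi * \<i> * of_nat n * z / of_nat (N * D * t)) = 0"
      if "n \<notin> range (\<lambda>n. n * s)" for n
      using that by (auto simp: a'_def dvd_def mult.commute)
    ultimately show ?thesis
      using sums_mono_reindex[of "\<lambda>n. n * s"
        "\<lambda>n. a' n * exp (2 * of_real pi * \<i> * of_nat n * z / of_nat (N * D * t))" "h z"]
      by blast
  qed
  then show ?thesis
    unfolding q_expansion_def by blast
qed

lemma q_expansion_raise_level:
  assumes "q_expansion N f a" "N \<ge> 1" "t \<ge> 1"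
  shows "\<exists>a'. q_expansion (N * t) f a'"
  using q_expansion_affine[of N f a 1 1 t f 1 0] assms by simp

lemma q_expansion_add:
  "q_expansion N f a \<Longrightarrow> q_expansion N g b \<Longrightarrow> q_expansion N (f + g) (a + b)"
  by (auto simp: q_expansion_def distrib_right intro!: sums_add)

lemma q_expansion_scale: 
  "q_expansion N f a \<Longrightarrow> q_expansion N (\<lambda>z. c * f z) (\<lambda>n. c * a n)"
  by (auto simp: q_expansion_def mult.assoc intro!: sums_mult)

lemma q_expansion_mult:
  assumes "q_expansion N f a" "q_expansion N g b" "N \<ge> 1"
  shows "q_expansion N (f * g) (\<lambda>n. \<Sum>i\<le>n. a i * b (n - i))"
  unfolding q_expansion_iff_powers
proof (intro allI impI)
  fix z :: complex assume z: "Im z > 0"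
  define q where "q = exp (2 * of_real pi * \<i> * z / of_nat N)"
  have "(\<lambda>n. \<Sum>i\<le>n. a i * q ^ i * (b (n - i) * q ^ (n - i)))
      sums ((\<Sum>n. a n * q ^ n) * (\<Sum>n. b n * q ^ n))"
    using q_expansion_abs_summable[OF assms(1,3) z] q_expansion_abs_summable[OF assms(2,3) z]
    unfolding q_def by (rule Cauchy_product_sums)
  moreover have "(\<Sum>n. a n * q ^ n) = f z" "(\<Sum>n. b n * q ^ n) = g z"
    using assms z unfolding q_expansion_iff_powers q_def by (auto intro!: sums_unique[symmetric])
  moreover have "(\<Sum>i\<le>n. a i * q ^ i * (b (n - i) * q ^ (n - i))) = (\<Sum>i\<le>n. a i * b (n - i)) * q ^ n" for n
  proof -
    have "a i * q ^ i * (b (n - i) * q ^ (n - i)) = a i * b (n - i) * q ^ n" if "i \<le> n" for i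
    proof -
      have "q ^ n = q ^ i * q ^ (n - i)"
        using that by (simp add: power_add[symmetric])
      then show ?thesis
        by simp
    qed
    then show ?thesis
      unfolding sum_distrib_right by (intro sum.cong refl) simp
  qed
  ultimately show "(\<lambda>n. (\<Sum>i\<le>n. a i * b (n - i)) * exp (2 * of_real pi * \<i> * z / of_nat N) ^ n)
      sums (f * g) z"
    by (simp add: q_def)
qed

section \<open>Stability of modular forms under the slash action\<close>

definition ratmat :: "int^2^2 \<Rightarrow> rat^2^2" where
  "ratmat A = (\<chi> i j. of_int (A $ i $ j))"

definition mat2 :: "'a \<Rightarrow> 'a \<Rightarrow> 'a \<Rightarrow> 'a \<Rightarrow> 'a^2^2" where
  "mat2 a b c d = (\<chi> i j. if i = 1 then (if j = 1 then a else b) else (if j = 1 then c else d))"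

lemma mat2_nth [simp]:
  "mat2 a b c d $ 1 $ 1 = a" "mat2 a b c d $ 1 $ 2 = b"
  "mat2 a b c d $ 2 $ 1 = c" "mat2 a b c d $ 2 $ 2 = d"
  by (simp_all add: mat2_def)

lemma mat2_eq_iff:
  "A = B \<longleftrightarrow> A $ 1 $ 1 = B $ 1 $ 1 \<and> A $ 1 $ 2 = B $ 1 $ 2 \<and> A $ 2 $ 1 = B $ 2 $ 1 \<and> A $ 2 $ 2 = B $ 2 $ 2"
  for A B :: "'a^2^2"
  unfolding vec_eq_iff forall_2 by blast

lemma mult_mat2_nth: "(A ** B) $ i $ j = A $ i $ 1 * B $ 1 $ j + A $ i $ 2 * B $ 2 $ j"
  for A B :: "'a::semiring_1^2^2"
  by (simp add: matrix_matrix_mult_def sum_2)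

lemma ratmat_mult: "ratmat (A ** B) = ratmat A ** ratmat B"
  by (simp add: vec_eq_iff ratmat_def mult_mat2_nth)

lemma det_ratmat: "det (ratmat A) = of_int (det A)"
  by (simp add: ratmat_def det_2)

lemma Gamma_level_eq:
  "Gamma_level N = ratmat ` {A. det A = 1 \<and> (\<forall>i j. [A $ i $ j = mat 1 $ i $ j] (mod int N))}"
  unfolding Gamma_level_def ratmat_def ..

lemma SL2Z_eq: "SL2Z = ratmat ` {A. det A = 1}"
  by (simp add: Gamma_level_eq)

lemma Gamma_level_GL2Q: "\<gamma> \<in> Gamma_level N \<Longrightarrow> \<gamma> \<in> GL2Q_pos"
  by (auto simp: Gamma_level_eq GL2Q_pos_def det_ratmat)

lemma Gamma_level_multiple_subset: "Gamma_level (N * t) \<subseteq> Gamma_level N"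
proof -
  have "[x = y] (mod int N)" if "[x = y] (mod int (N * t))" for x y
    using that by (rule cong_dvd_modulus) simp
  then show ?thesis
    unfolding Gamma_level_eq by (intro image_mono) blast
qed

lemma rational_matrix_denominator:
  "\<exists>e>0. \<exists>A. \<gamma> = mat (1 / of_int e) ** ratmat A"
proof -
  have "\<exists>a b. b > 0 \<and> r = of_int a / of_int b" for r :: rat
    by (metis Fract_of_int_quotient Rat_cases)
  then obtain num den where nd: "\<And>r::rat. den r > (0::int)" "\<And>r::rat. r = of_int (num r) / of_int (den r)"
    by metis
  define p where "p = den (\<gamma> $ 1 $ 1)"
  define q where "q = den (\<gamma> $ 1 $ 2)"
  define r where "r = den (\<gamma> $ 2 $ 1)"
  define s where "s = den (\<gamma> $ 2 $ 2)"
  have pos: "p > 0" "q > 0" "r > 0" "s > 0"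
    using nd by (simp_all add: p_def q_def r_def s_def)
  define A where "A = mat2 (num (\<gamma> $ 1 $ 1) * q * r * s) (num (\<gamma> $ 1 $ 2) * p * r * s)
    (num (\<gamma> $ 2 $ 1) * p * q * s) (num (\<gamma> $ 2 $ 2) * p * q * r)"
  have "\<gamma> = mat (1 / of_int (p * q * r * s)) ** ratmat A"
    unfolding mat2_eq_iff mult_mat2_nth using pos nd(2)[of "\<gamma> $ 1 $ 1"] nd(2)[of "\<gamma> $ 1 $ 2"]
      nd(2)[of "\<gamma> $ 2 $ 1"] nd(2)[of "\<gamma> $ 2 $ 2"]
    by (simp add: mat_def ratmat_def A_def p_def[symmetric] q_def[symmetric] r_def[symmetric]
      s_def[symmetric] field_simps)
  moreover have "p * q * r * s > 0"
    using pos by simp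
  ultimately show ?thesis
    by blast
qed

lemma mat_scalar_commute: "mat c ** A = A ** mat c" for A :: "'a::comm_semiring_1^2^2"
  by (simp add: mat2_eq_iff mult_mat2_nth mat_def mult.commute)

lemma det_mat_scalar: "det (mat c :: 'a::comm_ring_1^2^2) = c\<^sup>2"
  by (simp add: det_2 mat_def power2_eq_square)

lemma GL2Q_integral_decomp:
  assumes "\<gamma> \<in> GL2Q_pos"
  obtains e A where "e > 0" "\<gamma> = mat (1 / of_int e) ** ratmat A" "det A > 0"
proof -
  obtain e A where eA: "e > 0" "\<gamma> = mat (1 / of_int e) ** ratmat A"
    using rational_matrix_denominator by blast
  have "det \<gamma> = (1 / of_int e)\<^sup>2 * of_int (det A)"
    by (simp add: eA det_mul det_mat_scalar det_ratmat)
  moreover have "det \<gamma> > 0"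
    using assms by (simp add: GL2Q_pos_def)
  ultimately have "(of_int (det A) :: rat) > 0"
    using eA(1) by (simp add: zero_less_mult_iff)
  with eA that show ?thesis
    by simp
qed

text \<open>Writing \<open>\<delta> = 1 + N D X\<close> with \<open>D = det A\<close>, the conjugate is \<open>A \<delta> A\<^sup>-\<^sup>1 = 1 + N A X adj(A)\<close>,
because \<open>D A\<^sup>-\<^sup>1\<close> is the adjugate of \<open>A\<close>. It is integral and congruent to \<open>1\<close> modulo \<open>N\<close>.\<close>

lemma conj_Gamma_level:
  assumes "det A > 0" "\<delta> \<in> Gamma_level (N * nat (det A))"
  shows "\<exists>\<delta>'\<in>Gamma_level N. ratmat A ** \<delta> = \<delta>' ** ratmat A"
proof -
  define D where "D = det A"
  have D: "D > 0" "int (N * nat (det A)) = int N * D"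
    using assms(1) by (simp_all add: D_def)
  obtain E where E: "\<delta> = ratmat E" "det E = 1"
      "\<And>i j. [E $ i $ j = mat 1 $ i $ j] (mod (int N * D))"
    using assms(2) unfolding Gamma_level_eq D(2) by auto
  have "\<exists>x. E $ i $ j = mat 1 $ i $ j + int N * D * x" for i j
    using E(3)[of i j] by (metis cong_iff_lin cong_sym)
  then obtain X where X: "\<And>i j. E $ i $ j = mat 1 $ i $ j + int N * D * X i j"
    by metis
  define a b c d where "a = A $ 1 $ 1" and "b = A $ 1 $ 2" and "c = A $ 2 $ 1" and "d = A $ 2 $ 2"
  have D_eq: "D = a * d - b * c"
    by (simp add: D_def det_2 a_def b_def c_def d_def)
  define x y z w where "x = X 1 1" and "y = X 1 2" and "z = X 2 1" and "w = X 2 2"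
  (* The matrix A X adj(A), written out. *)
  define Y where "Y = mat2 ((a*x+b*z)*d - (a*y+b*w)*c) ((a*y+b*w)*a - (a*x+b*z)*b)
    ((c*x+d*z)*d - (c*y+d*w)*c) ((c*y+d*w)*a - (c*x+d*z)*b)"
  define E' :: "int^2^2" where "E' = (\<chi> i j. mat 1 $ i $ j + int N * Y $ i $ j)"
  have comm: "A ** E = E' ** A"
    unfolding mat2_eq_iff mult_mat2_nth X E'_def a_def[symmetric] b_def[symmetric] c_def[symmetric]
      d_def[symmetric] x_def[symmetric] y_def[symmetric] z_def[symmetric] w_def[symmetric]
    by (simp add: mat_def Y_def D_eq a_def[symmetric] b_def[symmetric] c_def[symmetric]
      d_def[symmetric] algebra_simps)
  have "det E' * D = D"
    using arg_cong[OF comm, of det] by (simp add: det_mul E(2) D_def)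
  then have "det E' = 1"
    using D by simp
  moreover have "[E' $ i $ j = mat 1 $ i $ j] (mod int N)" for i j
    by (simp add: E'_def cong_def)
  ultimately have "ratmat E' \<in> Gamma_level N"
    unfolding Gamma_level_eq by blast
  moreover have "ratmat A ** \<delta> = ratmat E' ** ratmat A"
    unfolding E(1) ratmat_mult[symmetric] comm ..
  ultimately show ?thesis
    by blast
qed

text \<open>Bezout coefficients for the first column give the unimodular matrix that clears its lower entry.
This reduces every cusp condition for a translate of a form to one for the form itself.\<close>

lemma hermite_form:
  assumes "det B > 0"
  obtains S g h d where "det S = 1" "B = S ** mat2 g h 0 d" "g > 0" "d > 0" "g * d = det (B :: int^2^2)"
proof -
  define g where "g = gcd (B $ 1 $ 1) (B $ 2 $ 1)"
  have "g \<noteq> 0"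
    using assms by (auto simp: g_def det_2)
  then have g: "g > 0"
    by (simp add: g_def order_less_le)
  obtain p r where pr: "B $ 1 $ 1 = g * p" "B $ 2 $ 1 = g * r"
    unfolding g_def by (meson dvdE gcd_dvd1 gcd_dvd2)
  obtain u v where "u * B $ 1 $ 1 + v * B $ 2 $ 1 = g"
    using bezout_int unfolding g_def by blast
  then have "g * (u * p + v * r) = g * 1"
    by (simp add: pr algebra_simps)
  then have uv: "u * p + v * r = 1"
    using g by simp
  define h where "h = u * B $ 1 $ 2 + v * B $ 2 $ 2"
  define d where "d = p * B $ 2 $ 2 - r * B $ 1 $ 2"
  define S where "S = mat2 p (- v) r u"
  have S: "det S = 1"
    using uv by (simp add: S_def det_2 mult.commute)
  have gd: "g * d = det B"
    by (simp add: d_def det_2 pr algebra_simps)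
  have 1: "p * h - v * d = (u * p + v * r) * B $ 1 $ 2" "r * h + u * d = (u * p + v * r) * B $ 2 $ 2"
    by (simp_all add: h_def d_def algebra_simps)
  have "B = S ** mat2 g h 0 d"
    using 1 unfolding uv by (simp add: mat2_eq_iff mult_mat2_nth S_def pr mult.commute)
  moreover have "d > 0"
    using gd g assms by (metis zero_less_mult_pos)
  ultimately show ?thesis
    using that S g gd by blast
qed

lemma modforms_level_off_H: "f \<in> modforms_level k N \<Longrightarrow> off_H_zero f"
  by (simp add: modforms_level_def off_H_zero_def)

lemma modforms_level_multiple:
  assumes "f \<in> modforms_level k N" "N \<ge> 1" "t \<ge> 1"
  shows "f \<in> modforms_level k (N * t)"
proof -
  have "\<exists>a. q_expansion (N * t) (slash k f \<gamma>) a" if "\<gamma> \<in> SL2Z" for \<gamma>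
  proof -
    obtain a where "q_expansion N (slash k f \<gamma>) a"
      using assms(1) \<open>\<gamma> \<in> SL2Z\<close> unfolding modforms_level_def by blast
    then show ?thesis
      using q_expansion_raise_level assms by blast
  qed
  then show ?thesis
    using assms(1) Gamma_level_multiple_subset[of N t] unfolding modforms_level_def by blast
qed

lemma modforms_common_level:
  assumes "f \<in> modforms i" "g \<in> modforms j"
  obtains N where "N \<ge> 1" "f \<in> modforms_level i N" "g \<in> modforms_level j N"
proof -
  obtain N M where "N \<ge> 1" "f \<in> modforms_level i N" "M \<ge> 1" "g \<in> modforms_level j M"
    using assms unfolding modforms_def by auto
  then show ?thesis
    using that[of "N * M"] modforms_level_multiple[of f i N M] modforms_level_multiple[of g j M N]
    by (simp add: mult.commute)
qed

lemma modformsI: "N \<ge> 1 \<Longrightarrow> f \<in> modforms_level k N \<Longrightarrow> f \<in> modforms k"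
  unfolding modforms_def by auto

lemma modforms_off_H: "f \<in> modforms k \<Longrightarrow> off_H_zero f"
  unfolding modforms_def using modforms_level_off_H by auto

lemma modforms_holomorphic: "f \<in> modforms k \<Longrightarrow> f holomorphic_on {z. Im z > 0}"
  by (auto simp: modforms_def modforms_level_def)

lemma modforms_q_expansion:
  assumes "f \<in> modforms k"
  obtains N a where "N \<ge> 1" "q_expansion N f a"
proof -
  have "mat 1 = ratmat (mat 1)"
    by (simp add: ratmat_def mat_def vec_eq_iff)
  then have "mat 1 \<in> SL2Z"
    unfolding SL2Z_eq by simp
  with assms obtain N a where "N \<ge> 1" "q_expansion N (slash k f (mat 1)) a"
    unfolding modforms_def modforms_level_def by fastforce
  then show ?thesis
    using that by (simp add: slash_one)
qed

lemma modforms_add: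
  assumes "f \<in> modforms k" "g \<in> modforms k"
  shows "f + g \<in> modforms k"
proof -
  obtain N where "N \<ge> 1" and f: "f \<in> modforms_level k N" and g: "g \<in> modforms_level k N"
    using modforms_common_level[OF assms] .
  have "f + g \<in> modforms_level k N"
    unfolding modforms_level_def mem_Collect_eq slash_add
  proof (intro conjI ballI allI impI)
    show "f + g holomorphic_on {z. Im z > 0}"
      using f g unfolding modforms_level_def plus_fun_def by (auto intro: holomorphic_intros)
    show "(f + g) z = 0" if "Im z \<le> 0" for z
      using f g that by (simp add: modforms_level_def)
    show "slash k f \<gamma> + slash k g \<gamma> = f + g" if "\<gamma> \<in> Gamma_level N" for \<gamma>
      using f g that by (simp add: modforms_level_def)
    show "\<exists>a. q_expansion N (slash k f \<gamma> + slash k g \<gamma>) a" if "\<gamma> \<in> SL2Z" for \<gamma>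
      using f g that unfolding modforms_level_def by (blast intro: q_expansion_add)
  qed
  then show ?thesis
    using \<open>N \<ge> 1\<close> by (rule modformsI[rotated])
qed

lemma modforms_scale:
  assumes "f \<in> modforms k"
  shows "(\<lambda>z. c * f z) \<in> modforms k"
proof -
  obtain N where "N \<ge> 1" and f: "f \<in> modforms_level k N"
    using assms unfolding modforms_def by auto
  have "(\<lambda>z. c * f z) \<in> modforms_level k N"
    unfolding modforms_level_def mem_Collect_eq slash_scale
  proof (intro conjI ballI allI impI)
    show "(\<lambda>z. c * f z) holomorphic_on {z. Im z > 0}"
      using f unfolding modforms_level_def by (auto intro: holomorphic_intros)
    show "c * f z = 0" if "Im z \<le> 0" for z
      using f that by (simp add: modforms_level_def)
    show "(\<lambda>z. c * slash k f \<gamma> z) = (\<lambda>z. c * f z)" if "\<gamma> \<in> Gamma_level N" for \<gamma>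
      using f that by (simp add: modforms_level_def)
    show "\<exists>a. q_expansion N (\<lambda>z. c * slash k f \<gamma> z) a" if "\<gamma> \<in> SL2Z" for \<gamma>
      using f that unfolding modforms_level_def by (blast intro: q_expansion_scale)
  qed
  then show ?thesis
    using \<open>N \<ge> 1\<close> by (rule modformsI[rotated])
qed

lemma modforms_mult:
  assumes "f \<in> modforms i" "g \<in> modforms j"
  shows "f * g \<in> modforms (i + j)"
proof -
  obtain N where N: "N \<ge> 1" and f: "f \<in> modforms_level i N" and g: "g \<in> modforms_level j N"
    using modforms_common_level[OF assms] .
  have "f * g \<in> modforms_level (i + j) N"
    unfolding modforms_level_def mem_Collect_eq
  proof (intro conjI ballI allI impI)
    show "f * g holomorphic_on {z. Im z > 0}"
      using f g unfolding modforms_level_def times_fun_def by (auto intro: holomorphic_intros)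
    show "(f * g) z = 0" if "Im z \<le> 0" for z
      using f g that by (simp add: modforms_level_def)
    show "slash (i + j) (f * g) \<gamma> = f * g" if "\<gamma> \<in> Gamma_level N" for \<gamma>
      using f g that by (simp add: modforms_level_def slash_mult)
    show "\<exists>a. q_expansion N (slash (i + j) (f * g) \<gamma>) a" if "\<gamma> \<in> SL2Z" for \<gamma>
      using f g that N unfolding modforms_level_def slash_mult
      by (blast intro: q_expansion_mult)
  qed
  then show ?thesis
    using \<open>N \<ge> 1\<close> by (rule modformsI[rotated])
qed

text \<open>Let \<open>e \<gamma> = A\<close> be integral of determinant \<open>D\<close>; scalar matrices are central, so the level only
grows from \<open>N\<close> to \<open>N D\<close>. Invariance follows from \<open>conj_Gamma_level\<close>. For the cusps, the matrix
\<open>A \<sigma>\<close> is factored by \<open>hermite_form\<close> as a unimodular matrix times an upper triangular one, and the latter acts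
on Fourier expansions by \<open>q_expansion_affine\<close>.\<close>

lemma modforms_slash:
  assumes "f \<in> modforms k" "\<gamma> \<in> GL2Q_pos"
  shows "slash k f \<gamma> \<in> modforms k"
proof -
  obtain N where N: "N \<ge> 1" and f: "f \<in> modforms_level k N"
    using assms unfolding modforms_def by auto
  note off = modforms_level_off_H[OF f]
  obtain e A where eA: "e > 0" "\<gamma> = mat (1 / of_int e) ** ratmat A" "det A > 0"
    using GL2Q_integral_decomp[OF assms(2)] .
  have scal: "mat (1 / of_int e) \<in> GL2Q_pos"
    using eA(1) by (simp add: GL2Q_pos_def det_mat_scalar)
  define D where "D = nat (det A)"
  have "slash k f \<gamma> \<in> modforms_level k (N * D)"
    unfolding modforms_level_def mem_Collect_eq
  proof (intro conjI ballI allI impI)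
    show "slash k f \<gamma> holomorphic_on {z. Im z > 0}"
      using f assms(2) by (simp add: modforms_level_def slash_holomorphic)
    show "slash k f \<gamma> z = 0" if "Im z \<le> 0" for z
      using off_H_zero_slash[OF assms(2) off] that by (simp add: off_H_zero_def)
    show "slash k (slash k f \<gamma>) \<delta> = slash k f \<gamma>" if \<delta>: "\<delta> \<in> Gamma_level (N * D)" for \<delta>
    proof -
      obtain \<delta>' where \<delta>': "\<delta>' \<in> Gamma_level N" "ratmat A ** \<delta> = \<delta>' ** ratmat A"
        using conj_Gamma_level[OF eA(3)] \<delta> unfolding D_def by blast
      have "\<gamma> ** \<delta> = mat (1 / of_int e) ** (ratmat A ** \<delta>)"
        by (simp add: eA(2) matrix_mul_assoc)
      also have "\<dots> = mat (1 / of_int e) ** \<delta>' ** ratmat A"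
        by (simp add: \<delta>'(2) matrix_mul_assoc)
      also have "\<dots> = \<delta>' ** \<gamma>"
        unfolding mat_scalar_commute by (simp add: eA(2) matrix_mul_assoc)
      finally have "slash k (slash k f \<gamma>) \<delta> = slash k f (\<delta>' ** \<gamma>)"
        using slash_slash[OF assms(2) Gamma_level_GL2Q[OF \<delta>] off] by simp
      also have "\<dots> = slash k (slash k f \<delta>') \<gamma>"
        using slash_slash[OF Gamma_level_GL2Q[OF \<delta>'(1)] assms(2) off] by simp
      also have "slash k f \<delta>' = f"
        using f \<delta>'(1) by (simp add: modforms_level_def)
      finally show ?thesis .
    qed
    show "\<exists>a. q_expansion (N * D) (slash k (slash k f \<gamma>) \<sigma>) a" if \<sigma>: "\<sigma> \<in> SL2Z" for \<sigma>
    proof -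
      obtain S0 where S0: "\<sigma> = ratmat S0" "det S0 = 1"
        using \<sigma> unfolding SL2Z_eq by blast
      have "det (A ** S0) > 0"
        using eA S0 by (simp add: det_mul)
      then obtain S g h d where S: "det S = 1" "A ** S0 = S ** mat2 g h 0 d" "g > 0" "d > 0"
          "g * d = det (A ** S0)"
        by (rule hermite_form)
      define T where "T = mat (1 / of_int e) ** ratmat (mat2 g h 0 d)"
      have "det (mat2 g h 0 d) > 0"
        using S(3,4) by (simp add: det_2)
      then have T: "T \<in> GL2Q_pos"
        using scal by (auto simp: T_def GL2Q_pos_def det_mul det_ratmat)
      have SSL: "ratmat S \<in> SL2Z"
        using S(1) unfolding SL2Z_eq by blast
      have "\<gamma> ** \<sigma> = mat (1 / of_int e) ** ratmat (A ** S0)"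
        by (simp add: eA(2) S0(1) ratmat_mult matrix_mul_assoc)
      also have "\<dots> = (mat (1 / of_int e) ** ratmat S) ** ratmat (mat2 g h 0 d)"
        by (simp only: S(2) ratmat_mult matrix_mul_assoc)
      also have "\<dots> = ratmat S ** T"
        unfolding mat_scalar_commute[of _ "ratmat S"] by (simp only: T_def matrix_mul_assoc)
      finally have slash_eq: "slash k (slash k f \<gamma>) \<sigma> = slash k (slash k f (ratmat S)) T"
        using slash_slash[OF assms(2) Gamma_level_GL2Q[OF \<sigma>] off]
          slash_slash[OF Gamma_level_GL2Q[OF SSL] T off] by simp
      obtain a where a: "q_expansion N (slash k f (ratmat S)) a"
        using f SSL unfolding modforms_level_def by blast
      have T_nth: "T $ 1 $ 1 = of_int g / of_int e" "T $ 1 $ 2 = of_int h / of_int e"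
          "T $ 2 $ 1 = 0" "T $ 2 $ 2 = of_int d / of_int e"
        by (simp_all add: T_def mult_mat2_nth mat_def ratmat_def)
      have "moeb T z = (of_nat (nat g) * z + of_int h) / of_nat (nat d)" for z
        using eA(1) S(3,4) by (simp add: moeb_def cocyc_def T_nth of_rat_divide field_simps)
      then have "\<exists>a. q_expansion (N * nat d * nat g) (slash k (slash k f (ratmat S)) T) a"
        using S(3,4) N
        by (intro q_expansion_affine[OF a, where A = "nat g" and D = "nat d" and B = h and t = "nat g"
           and c = "of_real (of_rat (det T) powr (real k / 2)) * inverse (of_rat (T $ 2 $ 2) ^ k)"])
          (auto simp: slash_def cocyc_def T_nth)
      moreover have "nat d * nat g = D"
        using S(3-5) S0(2) by (simp add: D_def det_mul nat_mult_distrib[symmetric] mult.commute)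
      ultimately show ?thesis
        unfolding slash_eq by (simp add: mult.assoc)
    qed
  qed
  moreover have "N * D \<ge> 1"
    using N eA(3) by (simp add: D_def)
  ultimately show ?thesis
    by (rule modformsI[rotated])
qed

lemma modforms_zero: "0 \<in> modforms k"
proof (rule modformsI)
  have "q_expansion 1 0 0"
    by (simp add: q_expansion_def)
  then show "0 \<in> modforms_level k 1"
    unfolding modforms_level_def zero_fun_def[symmetric]
    by (auto simp: slash_zero zero_fun_def[symmetric] simp del: One_nat_def)
      (simp_all add: zero_fun_def)
qed simp

section \<open>Homogeneous polynomials\<close>

lemma hom_polys_add: "P \<in> hom_polys r \<Longrightarrow> Q \<in> hom_polys r \<Longrightarrow> P + Q \<in> hom_polys r"
proof -
  assume "P \<in> hom_polys r" "Q \<in> hom_polys r"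
  then obtain c d where "P = (\<lambda>T1 T2. \<Sum>i\<le>r. c i * T1 ^ i * T2 ^ (r - i))"
      "Q = (\<lambda>T1 T2. \<Sum>i\<le>r. d i * T1 ^ i * T2 ^ (r - i))"
    unfolding hom_polys_def by auto
  then have "P + Q = (\<lambda>T1 T2. \<Sum>i\<le>r. (c i + d i) * T1 ^ i * T2 ^ (r - i))"
    by (simp add: fun_eq_iff sum.distrib distrib_right)
  then show ?thesis
    unfolding hom_polys_def by (auto intro!: exI[of _ "\<lambda>i. c i + d i"])
qed

lemma hom_polys_scale: "P \<in> hom_polys r \<Longrightarrow> (\<lambda>T1 T2. k * P T1 T2) \<in> hom_polys r"
proof -
  assume "P \<in> hom_polys r"
  then obtain c where "P = (\<lambda>T1 T2. \<Sum>i\<le>r. c i * T1 ^ i * T2 ^ (r - i))"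
    unfolding hom_polys_def by auto
  then have "(\<lambda>T1 T2. k * P T1 T2) = (\<lambda>T1 T2. \<Sum>i\<le>r. (k * c i) * T1 ^ i * T2 ^ (r - i))"
    by (simp add: fun_eq_iff sum_distrib_left mult.assoc)
  then show ?thesis
    unfolding hom_polys_def by (auto intro!: exI[of _ "\<lambda>i. k * c i"])
qed

lemma hom_polys_zero: "0 \<in> hom_polys r"
  unfolding hom_polys_def by (auto simp: fun_eq_iff intro!: exI[of _ "\<lambda>_. 0"])

lemma hom_polys_minus: "P \<in> hom_polys r \<Longrightarrow> - P \<in> hom_polys r"
  using hom_polys_scale[of P r "-1"] by (simp add: fun_Compl_def)

lemma hom_polys_diff: "P \<in> hom_polys r \<Longrightarrow> Q \<in> hom_polys r \<Longrightarrow> P - Q \<in> hom_polys r"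
  using hom_polys_add[OF _ hom_polys_minus] by fastforce

lemma hom_polys_sum: "(\<And>i. i \<in> I \<Longrightarrow> P i \<in> hom_polys r) \<Longrightarrow> (\<Sum>i\<in>I. P i) \<in> hom_polys r"
  by (induction I rule: infinite_finite_induct) (auto intro: hom_polys_add hom_polys_zero)

lemma sum_bipoly_apply: "(\<Sum>i\<in>I. P i) T1 T2 = (\<Sum>i\<in>I. P i T1 T2)" for P :: "'i \<Rightarrow> bipoly"
  by (induction I rule: infinite_finite_induct) auto

lemma hom_polys_sum_pointwise:
  assumes "\<And>i. i \<in> I \<Longrightarrow> P i \<in> hom_polys r"
  shows "(\<lambda>T1 T2. \<Sum>i\<in>I. P i T1 T2) \<in> hom_polys r"
proof -
  have "(\<Sum>i\<in>I. P i) = (\<lambda>T1 T2. \<Sum>i\<in>I. P i T1 T2)"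
    by (intro ext) (rule sum_bipoly_apply)
  moreover have "(\<Sum>i\<in>I. P i) \<in> hom_polys r"
    using assms by (rule hom_polys_sum)
  ultimately show ?thesis
    by simp
qed

lemma hom_polys_monomial:
  assumes "i \<le> r"
  shows "(\<lambda>T1 T2. T1 ^ i * T2 ^ (r - i)) \<in> hom_polys r"
proof -
  have "(\<Sum>j\<le>r. (if j = i then 1 else 0) * T1 ^ j * T2 ^ (r - j)) = T1 ^ i * T2 ^ (r - i)"
    for T1 T2 :: complex
  proof -
    have "(\<Sum>j\<le>r. (if j = i then 1 else 0) * T1 ^ j * T2 ^ (r - j))
        = (\<Sum>j\<le>r. if j = i then T1 ^ j * T2 ^ (r - j) else 0)"
      by (intro sum.cong) auto
    then show ?thesis
      using assms by simp
  qed
  then show ?thesis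
    unfolding hom_polys_def by (auto simp: fun_eq_iff intro!: exI[of _ "\<lambda>j. if j = i then 1 else 0"])
qed

lemma hom_polys_mult:
  assumes "P \<in> hom_polys r" "Q \<in> hom_polys s"
  shows "(\<lambda>T1 T2. P T1 T2 * Q T1 T2) \<in> hom_polys (r + s)"
proof -
  obtain c d where P: "P = (\<lambda>T1 T2. \<Sum>i\<le>r. c i * T1 ^ i * T2 ^ (r - i))"
      and Q: "Q = (\<lambda>T1 T2. \<Sum>i\<le>s. d i * T1 ^ i * T2 ^ (s - i))"
    using assms unfolding hom_polys_def by auto
  have mon: "T1 ^ i * T2 ^ (r - i) * (T1 ^ j * T2 ^ (s - j)) = T1 ^ (i + j) * T2 ^ (r + s - (i + j))"
    if "i \<le> r" "j \<le> s" for i j and T1 T2 :: complex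
  proof -
    have "r + s - (i + j) = (r - i) + (s - j)"
      using that by simp
    then show ?thesis
      by (simp add: power_add)
  qed
  have "(\<lambda>T1 T2. P T1 T2 * Q T1 T2) =
      (\<lambda>T1 T2. \<Sum>i\<le>r. \<Sum>j\<le>s. c i * d j * (T1 ^ (i + j) * T2 ^ (r + s - (i + j))))"
    unfolding P Q sum_product
  proof (intro ext sum.cong refl)
    fix T1 T2 :: complex and i j assume "i \<in> {..r}" "j \<in> {..s}"
    then have "T1 ^ i * T2 ^ (r - i) * (T1 ^ j * T2 ^ (s - j)) = T1 ^ (i + j) * T2 ^ (r + s - (i + j))"
      using mon by simp
    from this[symmetric] show "c i * T1 ^ i * T2 ^ (r - i) * (d j * T1 ^ j * T2 ^ (s - j))
        = c i * d j * (T1 ^ (i + j) * T2 ^ (r + s - (i + j)))"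
      by (simp only: mult_ac)
  qed
  also have "\<dots> \<in> hom_polys (r + s)"
    by (intro hom_polys_sum_pointwise hom_polys_scale hom_polys_monomial) auto
  finally show ?thesis .
qed

lemma hom_polys_linear: "(\<lambda>T1 T2. a * T1 + b * T2) \<in> hom_polys 1"
  unfolding hom_polys_def by (auto simp: fun_eq_iff intro!: exI[of _ "\<lambda>i. if i = 0 then b else a"])

lemma hom_polys_power:
  assumes "P \<in> hom_polys 1"
  shows "(\<lambda>T1 T2. P T1 T2 ^ n) \<in> hom_polys n"
proof (induction n)
  case 0
  show ?case
    using hom_polys_monomial[of 0 0] by simp
next
  case (Suc n)
  then show ?case
    using hom_polys_mult[OF assms Suc] by simp
qed

lemma hom_polys_act:
  assumes "P \<in> hom_polys r"
  shows "poly_act r \<gamma> P \<in> hom_polys r"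
proof -
  obtain c where P: "P = (\<lambda>T1 T2. \<Sum>i\<le>r. c i * T1 ^ i * T2 ^ (r - i))"
    using assms unfolding hom_polys_def by auto
  define L where "L = (\<lambda>T1 T2. of_rat (\<gamma> $ 1 $ 1) * T1 + of_rat (\<gamma> $ 2 $ 1) * T2 :: complex)"
  define M where "M = (\<lambda>T1 T2. of_rat (\<gamma> $ 1 $ 2) * T1 + of_rat (\<gamma> $ 2 $ 2) * T2 :: complex)"
  have "(\<lambda>T1 T2. L T1 T2 ^ i * M T1 T2 ^ (r - i)) \<in> hom_polys r" if "i \<le> r" for i
    using hom_polys_mult[OF hom_polys_power hom_polys_power, of L M i "r - i"] that hom_polys_linear
    by (simp add: L_def M_def)
  then have "(\<lambda>T1 T2. \<Sum>i\<le>r. c i * (L T1 T2 ^ i * M T1 T2 ^ (r - i))) \<in> hom_polys r"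
    by (intro hom_polys_sum_pointwise hom_polys_scale) auto
  then have "(\<lambda>T1 T2. of_real (of_rat (det \<gamma>) powr (- real r / 2)) *
      (\<Sum>i\<le>r. c i * (L T1 T2 ^ i * M T1 T2 ^ (r - i)))) \<in> hom_polys r"
    by (rule hom_polys_scale)
  then show ?thesis
    by (simp add: poly_act_def P L_def M_def mult.assoc)
qed

lemma poly_act_add: "poly_act r \<gamma> (P + Q) = poly_act r \<gamma> P + poly_act r \<gamma> Q"
  by (simp add: poly_act_def fun_eq_iff algebra_simps)

lemma poly_act_diff: "poly_act r \<gamma> (P - Q) = poly_act r \<gamma> P - poly_act r \<gamma> Q"
  by (simp add: poly_act_def fun_eq_iff algebra_simps)

lemma poly_act_minus: "poly_act r \<gamma> (- P) = - poly_act r \<gamma> P"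
  by (simp add: poly_act_def fun_eq_iff)

lemma poly_act_zero: "poly_act r \<gamma> 0 = 0"
  by (simp add: poly_act_def fun_eq_iff)

lemma poly_act_scale: "poly_act r \<gamma> (\<lambda>T1 T2. c * P T1 T2) = (\<lambda>T1 T2. c * poly_act r \<gamma> P T1 T2)"
  by (simp add: poly_act_def fun_eq_iff)

lemma poly_act_one: "poly_act r (mat 1) P = P"
  by (simp add: poly_act_def fun_eq_iff) (simp add: mat_def)

text \<open>The action substitutes the row vector \<open>(T\<^sub>1, T\<^sub>2) g\<close>, which makes it a left action.\<close>

lemma poly_act_mult:
  "poly_act r \<alpha> (poly_act r \<beta> P) = poly_act r (\<alpha> ** \<beta>) P"
proof (intro ext)
  fix T1 T2 :: complex
  have det: "(of_rat (det (\<alpha> ** \<beta>)) :: real) powr (- real r / 2)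
      = of_rat (det \<alpha>) powr (- real r / 2) * of_rat (det \<beta>) powr (- real r / 2)"
    unfolding det_mul of_rat_mult by (rule powr_mult)
  have args: "of_rat (\<beta> $ 1 $ j) * (of_rat (\<alpha> $ 1 $ 1) * T1 + of_rat (\<alpha> $ 2 $ 1) * T2)
      + of_rat (\<beta> $ 2 $ j) * (of_rat (\<alpha> $ 1 $ 2) * T1 + of_rat (\<alpha> $ 2 $ 2) * T2)
    = of_rat ((\<alpha> ** \<beta>) $ 1 $ j) * T1 + of_rat ((\<alpha> ** \<beta>) $ 2 $ j) * T2" for j
    by (simp add: mult_mat2_nth of_rat_add of_rat_mult algebra_simps)
  show "poly_act r \<alpha> (poly_act r \<beta> P) T1 T2 = poly_act r (\<alpha> ** \<beta>) P T1 T2"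
    unfolding poly_act_def det args by simp
qed

lemma F_poly_expand:
  "F_poly m z T1 T2 * w = (\<Sum>i\<le>m-2. (of_nat ((m-2) choose i) * T1 ^ i * T2 ^ (m-2 - i)) * (z ^ i * w))"
  unfolding F_poly_def binomial_ring sum_distrib_right
  by (intro sum.cong refl) (simp only: power_mult_distrib mult_ac)

text \<open>Any integration functional that commutes with finite linear combinations of \<open>z\<^sup>i h(z)\<close> sends
\<open>(z T\<^sub>1 + T\<^sub>2)\<^bsup>m-2\<^esup> h(z)\<close> to a homogeneous polynomial, by the binomial expansion. It is applied to
integrals along segments and along rays.\<close>

lemma F_poly_functional_hom:
  assumes "\<And>c. I (\<lambda>z. \<Sum>i\<le>m-2. c i * (z ^ i * h z)) = (\<Sum>i\<le>m-2. c i * J i)"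
  shows "(\<lambda>T1 T2. I (\<lambda>z. F_poly m z T1 T2 * h z)) \<in> hom_polys (m - 2)"
proof -
  have "(\<lambda>T1 T2. I (\<lambda>z. F_poly m z T1 T2 * h z))
      = (\<lambda>T1 T2. \<Sum>i\<le>m-2. (of_nat ((m-2) choose i) * T1 ^ i * T2 ^ (m-2 - i)) * J i)"
    unfolding F_poly_expand assms ..
  also have "\<dots> = (\<lambda>T1 T2. \<Sum>i\<le>m-2. (of_nat ((m-2) choose i) * J i) * (T1 ^ i * T2 ^ (m-2 - i)))"
    by (intro ext sum.cong refl) (simp only: mult_ac)
  also have "\<dots> \<in> hom_polys (m - 2)"
    by (intro hom_polys_sum_pointwise hom_polys_scale hom_polys_monomial) auto
  finally show ?thesis .
qed

lemma linepath_F_poly_hom: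
  assumes "continuous_on (closed_segment a b) h"
  shows "(\<lambda>T1 T2. contour_integral (linepath a b) (\<lambda>z. F_poly m z T1 T2 * h z)) \<in> hom_polys (m - 2)"
proof (rule F_poly_functional_hom)
  have int: "(\<lambda>z. c * (z ^ i * h z)) contour_integrable_on (linepath a b)" for c i
    using assms by (intro contour_integrable_continuous_linepath continuous_intros)
  show "contour_integral (linepath a b) (\<lambda>z. \<Sum>i\<le>m-2. c i * (z ^ i * h z))
      = (\<Sum>i\<le>m-2. c i * contour_integral (linepath a b) (\<lambda>z. z ^ i * h z))" for c
  proof -
    have "contour_integral (linepath a b) (\<lambda>z. \<Sum>i\<le>m-2. c i * (z ^ i * h z))
        = (\<Sum>i\<le>m-2. contour_integral (linepath a b) (\<lambda>z. c i * (z ^ i * h z)))"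
      using int by (intro contour_integral_sum) auto
    also have "\<dots> = (\<Sum>i\<le>m-2. c i * contour_integral (linepath a b) (\<lambda>z. z ^ i * h z))"
      using int[of 1] by (intro sum.cong refl contour_integral_lmul) simp
    finally show ?thesis .
  qed
qed

section \<open>The period integral as a cocycle\<close>

lemma segment_in_upper_half_plane:
  assumes "Im a > 0" "Im b > 0"
  shows "closed_segment a b \<subseteq> {z. Im z > 0}"
  using assms by (intro closed_segment_subset convex_halfspace_Im_gt) auto

lemma continuous_on_segment_in_upper_half_plane:
  assumes "h holomorphic_on {z. Im z > 0}" "Im a > 0" "Im b > 0"
  shows "continuous_on (closed_segment a b) h"
  using assms segment_in_upper_half_plane continuous_on_subset holomorphic_on_imp_continuous_on by metis

text \<open>The substitution of \<open>\<delta>\<close> turns \<open>z T\<^sub>1 + T\<^sub>2\<close> into \<open>(c z + d) (\<delta>z T\<^sub>1 + T\<^sub>2)\<close>. Of the automorphy factors,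
\<open>m - 2\<close> of the \<open>m\<close> cancel, and what remains is the derivative of the Moebius map: \<open>(\<delta> \<cdot> F) (g|\<delta>) dz\<close>
is the pullback of \<open>F g dz\<close>.\<close>

lemma F_poly_slash:
  assumes "m \<ge> 2" "\<delta> \<in> GL2Q_pos" "Im z > 0"
  shows "poly_act (m - 2) \<delta> (F_poly m z) T1 T2 * slash m g \<delta> z
    = F_poly m (moeb \<delta> z) T1 T2 * g (moeb \<delta> z) * (of_rat (det \<delta>) / (cocyc \<delta> z)\<^sup>2)"
proof -
  define r where "r = m - 2"
  have m: "m = r + 2"
    using assms(1) by (simp add: r_def)
  define D :: real where "D = of_rat (det \<delta>)"
  have D: "D > 0"
    using assms(2) by (simp add: D_def GL2Q_pos_def)
  define C where "C = cocyc \<delta> z"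
  have C: "C \<noteq> 0"
    using cocyc_nonzero[OF assms(2,3)] by (simp add: C_def)
  have "z * (of_rat (\<delta> $ 1 $ 1) * T1 + of_rat (\<delta> $ 2 $ 1) * T2)
        + (of_rat (\<delta> $ 1 $ 2) * T1 + of_rat (\<delta> $ 2 $ 2) * T2)
      = (of_rat (\<delta> $ 1 $ 1) * z + of_rat (\<delta> $ 1 $ 2)) * T1 + C * T2"
    by (simp add: C_def cocyc_def algebra_simps)
  also have "\<dots> = C * (moeb \<delta> z * T1 + T2)"
    unfolding moeb_times_cocyc[OF assms(2,3), symmetric] by (simp add: C_def algebra_simps)
  finally have lin: "z * (of_rat (\<delta> $ 1 $ 1) * T1 + of_rat (\<delta> $ 2 $ 1) * T2)
        + (of_rat (\<delta> $ 1 $ 2) * T1 + of_rat (\<delta> $ 2 $ 2) * T2) = C * (moeb \<delta> z * T1 + T2)" .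
  have pw: "D powr (- real r / 2) * D powr (real m / 2) = D"
    using D by (simp add: powr_add[symmetric] m add_divide_distrib)
  have "poly_act (m - 2) \<delta> (F_poly m z) T1 T2 * slash m g \<delta> z
      = of_real (D powr (- real r / 2) * D powr (real m / 2)) * (C ^ r * inverse (C ^ m))
        * (F_poly m (moeb \<delta> z) T1 T2 * g (moeb \<delta> z))"
    unfolding poly_act_def slash_def F_poly_def lin
    by (simp add: r_def[symmetric] power_mult_distrib D_def[symmetric] C_def[symmetric] mult_ac)
  also have "C ^ r * inverse (C ^ m) = 1 / C\<^sup>2"
    using C by (simp add: m power_add divide_simps power2_eq_square)
  finally show ?thesis
    unfolding pw by (simp add: D_def C_def of_rat_complex mult_ac)
qed

lemma F_poly_times_holomorphic:
  "g holomorphic_on S \<Longrightarrow> (\<lambda>z. F_poly m z T1 T2 * g z) holomorphic_on S"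
  unfolding F_poly_def by (intro holomorphic_intros)

lemma linepath_integral_primitive:
  assumes "\<And>z. Im z > 0 \<Longrightarrow> (P has_field_derivative h z) (at z)" "Im a > 0" "Im b > 0"
  shows "contour_integral (linepath a b) h = P b - P a"
proof -
  have "(P has_field_derivative h z) (at z within {z. Im z > 0})" if "z \<in> {z. Im z > 0}" for z
    using that assms(1) by (simp add: has_field_derivative_at_within)
  moreover have "path_image (linepath a b) \<subseteq> {z. Im z > 0}"
    using segment_in_upper_half_plane[OF assms(2,3)] by simp
  ultimately have "(h has_contour_integral (P (pathfinish (linepath a b)) - P (pathstart (linepath a b))))
      (linepath a b)"
    by (intro contour_integral_primitive[where S = "{z. Im z > 0}"]) simp_all
  then show ?thesis
    by (simp add: contour_integral_unique)
qed

text \<open>The Moebius image of a segment is a circular arc in general, so the change of variables is carried out on a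
primitive \<open>P\<close> of \<open>F g\<close>, which exists on the convex upper half-plane, instead of on the path.\<close>

lemma tau_kernel_cocycle:
  assumes "m \<ge> 2" "Im z0 > 0" "\<delta> \<in> GL2Q_pos" "\<epsilon> \<in> GL2Q_pos" "g holomorphic_on {z. Im z > 0}"
  shows "tau_kernel m z0 (\<delta> ** \<epsilon>) g
    = tau_kernel m z0 \<delta> g + poly_act (m - 2) \<delta> (tau_kernel m z0 \<epsilon> (slash m g \<delta>))"
proof (intro ext)
  fix T1 T2
  define h where "h = (\<lambda>z. F_poly m z T1 T2 * g z)"
  have hol: "h holomorphic_on {z. Im z > 0}"
    unfolding h_def using assms(5) by (rule F_poly_times_holomorphic)
  obtain P where P0: "\<And>z. z \<in> {z. Im z > 0} \<Longrightarrow> (P has_field_derivative h z) (at z within {z. Im z > 0})"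
  proof (rule holomorphic_convex_primitive'[OF convex_halfspace_Im_gt open_halfspace_Im_gt hol])
    fix P assume "\<And>z. z \<in> {z. Im z > 0} \<Longrightarrow> (P has_field_derivative h z) (at z within {z. Im z > 0})"
    then show thesis
      by (rule that)
  qed
  have P: "(P has_field_derivative h z) (at z)" if "Im z > 0" for z
  proof -
    have "z \<in> {z. Im z > 0}"
      using that by simp
    then show ?thesis
      using P0[of z] at_within_open[OF _ open_halfspace_Im_gt, of z 0] by simp
  qed
  define c where "c = complex_of_real (of_rat (det \<delta>) powr (- (real (m - 2) / 2)))"
  define S1 where "S1 = of_rat (\<delta> $ 1 $ 1) * T1 + of_rat (\<delta> $ 2 $ 1) * T2"
  define S2 where "S2 = of_rat (\<delta> $ 1 $ 2) * T1 + of_rat (\<delta> $ 2 $ 2) * T2"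
  define k where "k = (\<lambda>z. F_poly m z S1 S2 * slash m g \<delta> z)"
  have k: "c * k z = h (moeb \<delta> z) * (of_rat (det \<delta>) / (cocyc \<delta> z)\<^sup>2)" if "Im z > 0" for z
    using F_poly_slash[OF assms(1,3) that, of T1 T2 g]
    by (simp add: c_def k_def S1_def S2_def h_def poly_act_def mult.assoc)
  have P\<delta>: "((\<lambda>z. P (moeb \<delta> z)) has_field_derivative c * k z) (at z)" if "Im z > 0" for z
    unfolding k[OF that]
    by (rule DERIV_chain2[OF P[OF Im_moeb_pos[OF assms(3) that]] moeb_has_field_derivative[OF assms(3) that]])
  have pos: "Im (moeb \<delta> z0) > 0" "Im (moeb \<epsilon> z0) > 0" "Im (moeb (\<delta> ** \<epsilon>) z0) > 0"
    using assms by (simp_all add: Im_moeb_pos mult_GL2Q)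
  have "k contour_integrable_on linepath z0 (moeb \<epsilon> z0)"
    unfolding k_def using assms pos
    by (intro contour_integrable_continuous_linepath continuous_on_segment_in_upper_half_plane
        F_poly_times_holomorphic slash_holomorphic) auto
  then have "c * contour_integral (linepath z0 (moeb \<epsilon> z0)) k
      = contour_integral (linepath z0 (moeb \<epsilon> z0)) (\<lambda>z. c * k z)"
    by (rule contour_integral_lmul[symmetric])
  also have "\<dots> = P (moeb \<delta> (moeb \<epsilon> z0)) - P (moeb \<delta> z0)"
    using linepath_integral_primitive[OF P\<delta> assms(2) pos(2)] .
  finally have "c * contour_integral (linepath z0 (moeb \<epsilon> z0)) k
      = P (moeb (\<delta> ** \<epsilon>) z0) - P (moeb \<delta> z0)"
    by (simp add: moeb_mult assms)
  moreover have "contour_integral (linepath z0 (moeb \<delta> z0)) h = P (moeb \<delta> z0) - P z0"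
      "contour_integral (linepath z0 (moeb (\<delta> ** \<epsilon>) z0)) h = P (moeb (\<delta> ** \<epsilon>) z0) - P z0"
    using linepath_integral_primitive[OF P assms(2)] pos by auto
  ultimately show "tau_kernel m z0 (\<delta> ** \<epsilon>) g T1 T2
    = (tau_kernel m z0 \<delta> g + poly_act (m - 2) \<delta> (tau_kernel m z0 \<epsilon> (slash m g \<delta>))) T1 T2"
    by (simp add: tau_kernel_def h_def[symmetric] poly_act_def c_def[symmetric] S1_def[symmetric]
      S2_def[symmetric] k_def[symmetric])
qed

lemma tau_kernel_add:
  assumes "Im z0 > 0" "\<gamma> \<in> GL2Q_pos" "g holomorphic_on {z. Im z > 0}" "h holomorphic_on {z. Im z > 0}"
  shows "tau_kernel m z0 \<gamma> (g + h) = tau_kernel m z0 \<gamma> g + tau_kernel m z0 \<gamma> h"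
proof -
  have "(\<lambda>z. F_poly m z T1 T2 * f z) contour_integrable_on linepath z0 (moeb \<gamma> z0)"
    if "f holomorphic_on {z. Im z > 0}" for f T1 T2
    using assms that
    by (intro contour_integrable_continuous_linepath continuous_on_segment_in_upper_half_plane
        F_poly_times_holomorphic) (auto simp: Im_moeb_pos)
  from contour_integral_add[OF this[OF assms(3)] this[OF assms(4)]] show ?thesis
    unfolding tau_kernel_def by (simp add: fun_eq_iff distrib_left)
qed

lemma tau_kernel_scale:
  assumes "Im z0 > 0" "\<gamma> \<in> GL2Q_pos" "g holomorphic_on {z. Im z > 0}"
  shows "tau_kernel m z0 \<gamma> (\<lambda>z. c * g z) = (\<lambda>T1 T2. c * tau_kernel m z0 \<gamma> g T1 T2)"
proof -
  have "(\<lambda>z. F_poly m z T1 T2 * g z) contour_integrable_on linepath z0 (moeb \<gamma> z0)" for T1 T2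
    using assms
    by (intro contour_integrable_continuous_linepath continuous_on_segment_in_upper_half_plane
        F_poly_times_holomorphic) (auto simp: Im_moeb_pos)
  then have "contour_integral (linepath z0 (moeb \<gamma> z0)) (\<lambda>z. c * (F_poly m z T1 T2 * g z))
      = c * contour_integral (linepath z0 (moeb \<gamma> z0)) (\<lambda>z. F_poly m z T1 T2 * g z)" for T1 T2
    by (rule contour_integral_lmul)
  moreover have "(\<lambda>z. F_poly m z T1 T2 * (c * g z)) = (\<lambda>z. c * (F_poly m z T1 T2 * g z))" for T1 T2
    by (intro ext mult.left_commute)
  ultimately show ?thesis
    unfolding tau_kernel_def by (simp only:)
qed

lemma tau_kernel_hom:
  assumes "Im z0 > 0" "\<gamma> \<in> GL2Q_pos" "g holomorphic_on {z. Im z > 0}"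
  shows "tau_kernel m z0 \<gamma> g \<in> hom_polys (m - 2)"
  unfolding tau_kernel_def
  by (rule linepath_F_poly_hom[OF continuous_on_segment_in_upper_half_plane[OF assms(3,1) Im_moeb_pos[OF assms(2,1)]]])

section \<open>The correction at the cusp\<close>

lemma modforms_common_q_expansion:
  assumes "f \<in> modforms k" "g \<in> modforms k"
  obtains N a b where "N \<ge> 1" "q_expansion N f a" "q_expansion N g b"
proof -
  obtain M M' a b where *: "M \<ge> 1" "q_expansion M f a" "M' \<ge> 1" "q_expansion M' g b"
    using assms modforms_q_expansion by metis
  obtain a' b' where "q_expansion (M * M') f a'" "q_expansion (M' * M) g b'"
    using q_expansion_raise_level[OF *(2,1,3)] q_expansion_raise_level[OF *(4,3,1)] by blast
  with * that[of "M * M'" a' b'] show ?thesis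
    by (simp add: mult.commute)
qed

lemma const_term_add:
  assumes "f \<in> modforms k" "g \<in> modforms k"
  shows "const_term (f + g) = const_term f + const_term g"
proof -
  obtain N a b where ab: "N \<ge> 1" "q_expansion N f a" "q_expansion N g b"
    using modforms_common_q_expansion[OF assms] .
  show ?thesis
    using const_term_eq[OF ab(2,1)] const_term_eq[OF ab(3,1)]
      const_term_eq[OF q_expansion_add[OF ab(2,3)] ab(1)] by simp
qed

lemma const_term_scale:
  assumes "f \<in> modforms k"
  shows "const_term (\<lambda>z. c * f z) = c * const_term f"
proof -
  obtain N a where a: "N \<ge> 1" "q_expansion N f a"
    using modforms_q_expansion[OF assms] .
  show ?thesis
    using const_term_eq[OF a(2,1)] const_term_eq[OF q_expansion_scale[OF a(2)] a(1)] by simp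
qed

lemma cusp_part_decay:
  assumes "f \<in> modforms k" "y > 0"
  shows "\<exists>c>0. \<exists>C. \<forall>z. Im z \<ge> y \<longrightarrow> norm (cusp_part f z) \<le> C * exp (- c * Im z)"
proof -
  obtain N a where a: "N \<ge> 1" "q_expansion N f a"
    using modforms_q_expansion[OF assms(1)] .
  obtain C where C: "\<And>z. Im z \<ge> y \<Longrightarrow> norm (f z - a 0) \<le> C * exp (- 2 * pi * Im z / real N)"
    using q_expansion_decay[OF a(2,1) assms(2)] by blast
  have "norm (cusp_part f z) \<le> C * exp (- (2 * pi / real N) * Im z)" if "Im z \<ge> y" for z
    using C[OF that] by (simp add: cusp_part_def const_term_eq[OF a(2,1)])
  moreover have "2 * pi / real N > 0"
    using a(1) by simp
  ultimately show ?thesis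
    by blast
qed

text \<open>A single term of the exponential series of \<open>c x\<close> is bounded by the whole series.\<close>

lemma power_le_exp:
  fixes x c :: real
  assumes "x \<ge> 0" "c > 0"
  shows "x ^ p \<le> fact p / c ^ p * exp (c * x)"
proof -
  have "(\<lambda>n. (c * x) ^ n /\<^sub>R fact n) sums exp (c * x)"
    by (rule exp_converges)
  then have "(\<Sum>n\<in>{p}. (c * x) ^ n /\<^sub>R fact n) \<le> exp (c * x)"
    using assms unfolding sums_iff by (metis (no_types, lifting) finite.emptyI finite.insertI
      fact_ge_zero inverse_nonnegative_iff_nonnegative less_imp_le mult_nonneg_nonneg
      real_scaleR_def sum_le_suminf zero_le_power)
  then show ?thesis
    using assms by (simp add: power_mult_distrib field_simps)
qed

text \<open>Half of the exponential decay rate absorbs the polynomial growth of \<open>z\<^sup>p\<close>; the other half gives an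
integrable majorant.\<close>

lemma ray_power_integrable:
  assumes "g \<in> modforms k" "Im z0 > 0"
  shows "(\<lambda>t::real. (z0 + \<i> * of_real t) ^ p * cusp_part g (z0 + \<i> * of_real t) * \<i>) integrable_on {0..}"
proof -
  define u where "u = (\<lambda>t::real. (z0 + \<i> * of_real t) ^ p * cusp_part g (z0 + \<i> * of_real t) * \<i>)"
  obtain c C where c: "c > 0" and C: "\<And>z. Im z \<ge> Im z0 \<Longrightarrow> norm (cusp_part g z) \<le> C * exp (- c * Im z)"
    using cusp_part_decay[OF assms(1,2)] by blast
  (* The majorant uses rate c/2 from power_le_exp, leaving exp (- (c/2) t). *)
  define D where "D = fact p / (c/2) ^ p * exp (c/2 * norm z0) * C"
  have bound: "norm (u t) \<le> D * exp (- (c/2) * t)" if "t \<in> {0..}" for t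
  proof -
    have t: "t \<ge> 0"
      using that by simp
    have "norm (z0 + \<i> * of_real t) \<le> norm z0 + t"
      using norm_triangle_ineq[of z0 "\<i> * of_real t"] t by (simp add: norm_mult)
    then have "norm (z0 + \<i> * of_real t) ^ p \<le> (norm z0 + t) ^ p"
      by (simp add: power_mono)
    also have "\<dots> \<le> fact p / (c/2) ^ p * exp (c/2 * (norm z0 + t))"
      using c t by (intro power_le_exp) auto
    finally have 1: "norm (z0 + \<i> * of_real t) ^ p \<le> fact p / (c/2) ^ p * exp (c/2 * (norm z0 + t))" .
    have 2: "norm (cusp_part g (z0 + \<i> * of_real t)) \<le> C * exp (- c * (Im z0 + t))"
      using C[of "z0 + \<i> * of_real t"] t by simp
    then have "0 \<le> C * exp (- c * (Im z0 + t))"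
      by (rule order_trans[OF norm_ge_zero])
    then have C0: "C \<ge> 0"
      by (simp add: zero_le_mult_iff)
    have "C * exp (- c * (Im z0 + t)) \<le> C * exp (- c * t)"
      using C0 c assms(2) by (intro mult_left_mono) auto
    with 2 have 3: "norm (cusp_part g (z0 + \<i> * of_real t)) \<le> C * exp (- c * t)"
      by linarith
    have "norm (u t) = norm (z0 + \<i> * of_real t) ^ p * norm (cusp_part g (z0 + \<i> * of_real t))"
      by (simp add: u_def norm_mult norm_power)
    also have "\<dots> \<le> (fact p / (c/2) ^ p * exp (c/2 * (norm z0 + t))) * (C * exp (- c * t))"
      by (rule mult_mono[OF 1 3]) (use c in simp_all)
    also have "\<dots> = fact p / (c/2) ^ p * C * (exp (c/2 * (norm z0 + t)) * exp (- c * t))"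
      by (simp only: mult_ac)
    also have "exp (c/2 * (norm z0 + t)) * exp (- c * t) = exp (c/2 * norm z0) * exp (- (c/2) * t)"
    proof -
      have "c/2 * (norm z0 + t) + (- c * t) = c/2 * norm z0 + (- (c/2) * t)"
        by (simp add: field_simps)
      then show ?thesis
        by (simp only: exp_add[symmetric])
    qed
    finally show ?thesis
      by (simp only: D_def mult_ac)
  qed
  have "continuous_on {0..} u"
  proof -
    have "continuous_on {z. Im z > 0} (cusp_part g)"
      unfolding cusp_part_def using modforms_holomorphic[OF assms(1)]
      by (intro continuous_intros holomorphic_on_imp_continuous_on)
    then have "continuous_on {0..} (\<lambda>t. cusp_part g (z0 + \<i> * of_real t))"
    proof (rule continuous_on_compose2)
      show "continuous_on {0..} (\<lambda>t. z0 + \<i> * of_real t)"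
        by (intro continuous_intros)
      show "(\<lambda>t. z0 + \<i> * of_real t) ` {0..} \<subseteq> {z. Im z > 0}"
        using assms(2) by auto
    qed
    then show ?thesis
      unfolding u_def by (intro continuous_intros)
  qed
  then have "u \<in> borel_measurable (lebesgue_on {0..})"
    by (intro continuous_imp_measurable_on_sets_lebesgue) auto
  moreover have "(\<lambda>t. D * exp (- (c/2) * t)) integrable_on {0..}"
    using has_integral_exp_minus_to_infinity[of "c/2" 0] c
    by (intro integrable_on_mult_right) (auto simp: integrable_on_def)
  moreover have "({0..} :: real set) \<in> sets lebesgue"
    by (intro sets_completionI_sets) simp
  ultimately have "u integrable_on {0..}"
    using bound measurable_bounded_by_integrable_imp_integrable by blast
  then show ?thesis
    by (simp add: u_def)
qed

lemma ray_F_integrable: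
  assumes "g \<in> modforms k" "Im z0 > 0"
  shows "(\<lambda>t::real. F_poly m (z0 + \<i> * of_real t) T1 T2 * cusp_part g (z0 + \<i> * of_real t) * \<i>) integrable_on {0..}"
proof -
  have "(\<lambda>t::real. \<Sum>i\<le>m-2. (of_nat ((m-2) choose i) * T1 ^ i * T2 ^ (m-2 - i)) *
      ((z0 + \<i> * of_real t) ^ i * cusp_part g (z0 + \<i> * of_real t) * \<i>)) integrable_on {0..}"
    by (intro integrable_sum integrable_on_mult_right ray_power_integrable[OF assms]) auto
  moreover have "F_poly m z T1 T2 * w * \<i> = (\<Sum>i\<le>m-2. (of_nat ((m-2) choose i) * T1 ^ i * T2 ^ (m-2 - i)) *
      (z ^ i * w * \<i>))" for z w
    unfolding F_poly_expand sum_distrib_right by (simp only: mult.assoc)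
  ultimately show ?thesis
    by (simp only:)
qed

lemma ray_F_hom:
  assumes "g \<in> modforms k" "Im z0 > 0"
  shows "(\<lambda>T1 T2. ray_integral z0 (\<lambda>z. F_poly m z T1 T2 * cusp_part g z)) \<in> hom_polys (m - 2)"
proof (rule F_poly_functional_hom)
  fix c
  have "ray_integral z0 (\<lambda>z. \<Sum>i\<le>m-2. c i * (z ^ i * cusp_part g z))
      = integral {0..} (\<lambda>t. \<Sum>i\<le>m-2. c i * ((z0 + \<i> * of_real t) ^ i * cusp_part g (z0 + \<i> * of_real t) * \<i>))"
    unfolding ray_integral_def sum_distrib_right by (simp only: mult.assoc)
  also have "\<dots> = (\<Sum>i\<le>m-2. integral {0..}
      (\<lambda>t. c i * ((z0 + \<i> * of_real t) ^ i * cusp_part g (z0 + \<i> * of_real t) * \<i>)))"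
    by (intro integral_sum integrable_on_mult_right ray_power_integrable[OF assms]) auto
  also have "\<dots> = (\<Sum>i\<le>m-2. c i * ray_integral z0 (\<lambda>z. z ^ i * cusp_part g z))"
    unfolding ray_integral_def integral_mult_right ..
  finally show "ray_integral z0 (\<lambda>z. \<Sum>i\<le>m-2. c i * (z ^ i * cusp_part g z))
      = (\<Sum>i\<le>m-2. c i * ray_integral z0 (\<lambda>z. z ^ i * cusp_part g z))" .
qed

lemma F_prim_hom: "F_prim m z0 \<in> hom_polys (m - 2)"
  using linepath_F_poly_hom[of 0 z0 "\<lambda>_. 1" m] by (simp add: F_prim_def[abs_def])

lemma ray_integral_scale: "ray_integral z0 (\<lambda>z. c * h z) = c * ray_integral z0 h"
  unfolding ray_integral_def mult.assoc integral_mult_right ..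

text \<open>This is minus the regularised integral of \<open>F g\<close> from \<open>z0\<close> to \<open>\<i>\<infinity>\<close>: the cusp part is integrated
along the ray, while the contribution of the constant term of \<open>g\<close>, which diverges there, is integrated
from \<open>z0\<close> to the base point \<open>0\<close> instead.\<close>

definition cusp_correction :: "nat \<Rightarrow> complex \<Rightarrow> (complex \<Rightarrow> complex) \<Rightarrow> bipoly" where
  "cusp_correction m z0 g = (\<lambda>T1 T2. F_prim m z0 T1 T2 * const_term g
     - ray_integral z0 (\<lambda>z. F_poly m z T1 T2 * cusp_part g z))"

text \<open>All terms after the first collect into a coboundary, since the action on polynomials commutes with
the integration over \<open>z\<close>.\<close>

lemma ttau_kernel_eq:
  "ttau_kernel m z0 \<gamma> g = tau_kernel m z0 \<gamma> g
     + (cusp_correction m z0 g - poly_act (m - 2) \<gamma> (cusp_correction m z0 (slash m g \<gamma>)))"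
proof (intro ext)
  fix T1 T2 :: complex
  define c where "c = complex_of_real (of_rat (det \<gamma>) powr (- real (m - 2) / 2))"
  define S1 where "S1 = of_rat (\<gamma> $ 1 $ 1) * T1 + of_rat (\<gamma> $ 2 $ 1) * T2"
  define S2 where "S2 = of_rat (\<gamma> $ 1 $ 2) * T1 + of_rat (\<gamma> $ 2 $ 2) * T2"
  have act: "poly_act (m - 2) \<gamma> P T1 T2 = c * P S1 S2" for P
    by (simp add: poly_act_def c_def S1_def S2_def)
  show "ttau_kernel m z0 \<gamma> g T1 T2 = (tau_kernel m z0 \<gamma> g
     + (cusp_correction m z0 g - poly_act (m - 2) \<gamma> (cusp_correction m z0 (slash m g \<gamma>)))) T1 T2"
    unfolding ttau_kernel_def plus_fun_apply minus_apply act mult.assoc[of c] ray_integral_scale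
    by (simp add: tau_kernel_def cusp_correction_def algebra_simps)
qed

lemma cusp_correction_add:
  assumes "Im z0 > 0" "g \<in> modforms m" "h \<in> modforms m"
  shows "cusp_correction m z0 (g + h) = cusp_correction m z0 g + cusp_correction m z0 h"
proof -
  have "cusp_part (g + h) z = cusp_part g z + cusp_part h z" for z
    by (simp add: cusp_part_def const_term_add[OF assms(2,3)])
  moreover have "ray_integral z0 (\<lambda>z. F_poly m z T1 T2 * (cusp_part g z + cusp_part h z))
      = ray_integral z0 (\<lambda>z. F_poly m z T1 T2 * cusp_part g z)
      + ray_integral z0 (\<lambda>z. F_poly m z T1 T2 * cusp_part h z)" for T1 T2
    unfolding ray_integral_def distrib_left distrib_right
    by (intro integral_add ray_F_integrable[OF assms(2,1)] ray_F_integrable[OF assms(3,1)])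
  ultimately show ?thesis
    by (simp add: cusp_correction_def fun_eq_iff const_term_add[OF assms(2,3)] algebra_simps
      del: distrib_left distrib_right)
qed

lemma cusp_correction_scale:
  assumes "g \<in> modforms m"
  shows "cusp_correction m z0 (\<lambda>z. c * g z) = (\<lambda>T1 T2. c * cusp_correction m z0 g T1 T2)"
proof (intro ext)
  fix T1 T2
  have "F_poly m z T1 T2 * cusp_part (\<lambda>z. c * g z) z = c * (F_poly m z T1 T2 * cusp_part g z)" for z
    by (simp add: cusp_part_def const_term_scale[OF assms] algebra_simps)
  note eq = this
  show "cusp_correction m z0 (\<lambda>z. c * g z) T1 T2 = c * cusp_correction m z0 g T1 T2"
    unfolding cusp_correction_def eq ray_integral_scale const_term_scale[OF assms]
    by (simp add: right_diff_distrib)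
qed

lemma cusp_correction_hom:
  assumes "Im z0 > 0" "g \<in> modforms m"
  shows "cusp_correction m z0 g \<in> hom_polys (m - 2)"
proof -
  have "cusp_correction m z0 g = (\<lambda>T1 T2. const_term g * F_prim m z0 T1 T2)
      - (\<lambda>T1 T2. ray_integral z0 (\<lambda>z. F_poly m z T1 T2 * cusp_part g z))"
    by (simp add: cusp_correction_def fun_eq_iff)
  also have "\<dots> \<in> hom_polys (m - 2)"
    by (intro hom_polys_diff hom_polys_scale F_prim_hom ray_F_hom[OF assms(2,1)])
  finally show ?thesis .
qed

section \<open>Period cocycles\<close>

text \<open>A crossed homomorphism on \<open>GL2Q_pos\<close> that is linear in a form of weight \<open>m\<close> and takes values in homogeneous
polynomials of degree \<open>m - 2\<close>; these properties are all that the algebraic part uses.\<close>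

locale period_cocycle =
  fixes m :: nat and K :: "rat^2^2 \<Rightarrow> (complex \<Rightarrow> complex) \<Rightarrow> bipoly"
  assumes K_add: "\<gamma> \<in> GL2Q_pos \<Longrightarrow> g \<in> modforms m \<Longrightarrow> h \<in> modforms m \<Longrightarrow>
      K \<gamma> (g + h) = K \<gamma> g + K \<gamma> h"
    and K_scale: "\<gamma> \<in> GL2Q_pos \<Longrightarrow> g \<in> modforms m \<Longrightarrow>
      K \<gamma> (\<lambda>z. c * g z) = (\<lambda>T1 T2. c * K \<gamma> g T1 T2)"
    and K_hom: "\<gamma> \<in> GL2Q_pos \<Longrightarrow> g \<in> modforms m \<Longrightarrow> K \<gamma> g \<in> hom_polys (m - 2)"
    and K_cocycle: "\<delta> \<in> GL2Q_pos \<Longrightarrow> \<epsilon> \<in> GL2Q_pos \<Longrightarrow> g \<in> modforms m \<Longrightarrow>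
      K (\<delta> ** \<epsilon>) g = K \<delta> g + poly_act (m - 2) \<delta> (K \<epsilon> (slash m g \<delta>))"
begin

lemma K_zero: "\<gamma> \<in> GL2Q_pos \<Longrightarrow> K \<gamma> 0 = 0"
  using K_scale[of \<gamma> 0 0] modforms_zero by (simp add: zero_fun_def)

lemma K_one: "g \<in> modforms m \<Longrightarrow> K (mat 1) g = 0"
  using K_cocycle[OF one_GL2Q one_GL2Q, of g] by (simp add: slash_one poly_act_one)

end

lemma period_cocycle_tau:
  assumes "m \<ge> 2" "Im z0 > 0"
  shows "period_cocycle m (tau_kernel m z0)"
proof
qed (auto intro!: tau_kernel_add tau_kernel_scale tau_kernel_hom tau_kernel_cocycle
  modforms_holomorphic assms)

text \<open>In the cocycle relation the correction terms telescope, because the slash action and the action on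
polynomials are compatible with matrix multiplication.\<close>

lemma period_cocycle_ttau:
  assumes "m \<ge> 2" "Im z0 > 0"
  shows "period_cocycle m (ttau_kernel m z0)"
proof -
  interpret tau: period_cocycle m "tau_kernel m z0"
    using assms by (rule period_cocycle_tau)
  show ?thesis
  proof
    fix \<gamma> g h assume "\<gamma> \<in> GL2Q_pos" "g \<in> modforms m" "h \<in> modforms m"
    then show "ttau_kernel m z0 \<gamma> (g + h) = ttau_kernel m z0 \<gamma> g + ttau_kernel m z0 \<gamma> h"
      unfolding ttau_kernel_eq slash_add
      by (simp add: tau.K_add cusp_correction_add[OF assms(2)] modforms_slash poly_act_add)
  next
    fix \<gamma> g c assume *: "\<gamma> \<in> GL2Q_pos" "g \<in> modforms m"
    show "ttau_kernel m z0 \<gamma> (\<lambda>z. c * g z) = (\<lambda>T1 T2. c * ttau_kernel m z0 \<gamma> g T1 T2)"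
      unfolding ttau_kernel_eq slash_scale tau.K_scale[OF *] cusp_correction_scale[OF *(2)]
        cusp_correction_scale[OF modforms_slash[OF *(2,1)]] poly_act_scale
      by (simp add: fun_eq_iff algebra_simps)
  next
    fix \<gamma> g assume "\<gamma> \<in> GL2Q_pos" "g \<in> modforms m"
    then show "ttau_kernel m z0 \<gamma> g \<in> hom_polys (m - 2)"
      unfolding ttau_kernel_eq
      by (intro hom_polys_add hom_polys_diff hom_polys_act tau.K_hom cusp_correction_hom assms(2)
        modforms_slash)
  next
    fix \<delta> \<epsilon> g assume *: "\<delta> \<in> GL2Q_pos" "\<epsilon> \<in> GL2Q_pos" "g \<in> modforms m"
    show "ttau_kernel m z0 (\<delta> ** \<epsilon>) g
      = ttau_kernel m z0 \<delta> g + poly_act (m - 2) \<delta> (ttau_kernel m z0 \<epsilon> (slash m g \<delta>))"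
      unfolding ttau_kernel_eq tau.K_cocycle[OF *] poly_act_add poly_act_diff poly_act_mult
        slash_slash[OF *(1,2) modforms_off_H[OF *(3)]]
      by (simp add: algebra_simps)
  qed
qed

section \<open>The crossed product\<close>

text \<open>The homogeneous element \<open>f U\<^bsub>\<gamma>\<^esub>\<close> with \<open>f\<close> of weight \<open>k\<close>.\<close>

definition single :: "rat^2^2 \<Rightarrow> nat \<Rightarrow> (complex \<Rightarrow> complex) \<Rightarrow> crossed" where
  "single \<gamma> k f = (\<lambda>\<delta> j. if \<delta> = \<gamma> \<and> j = k then f else 0)"

definition crossed_pairs :: "crossed \<Rightarrow> ((rat^2^2) \<times> nat) set" where
  "crossed_pairs a = {(\<gamma>, k). a \<gamma> k \<noteq> 0}"

lemma crossed_algD: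
  assumes "a \<in> crossed_alg"
  shows "a \<gamma> k \<in> modforms k" "finite (crossed_supp a)" "crossed_supp a \<subseteq> GL2Q_pos"
    "finite (crossed_pairs a)" "crossed_pairs a \<subseteq> GL2Q_pos \<times> UNIV"
proof -
  have "crossed_pairs a \<subseteq> (SIGMA \<gamma>:crossed_supp a. {k. a \<gamma> k \<noteq> 0})"
    by (auto simp: crossed_pairs_def crossed_supp_def)
  moreover have "finite (SIGMA \<gamma>:crossed_supp a. {k. a \<gamma> k \<noteq> 0})"
    using assms by (auto simp: crossed_alg_def modforms_graded_def intro!: finite_SigmaI)
  ultimately show "finite (crossed_pairs a)"
    by (rule finite_subset)
  show supp: "a \<gamma> k \<in> modforms k" "finite (crossed_supp a)" "crossed_supp a \<subseteq> GL2Q_pos"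
    using assms by (auto simp: crossed_alg_def modforms_graded_def)
  show "crossed_pairs a \<subseteq> GL2Q_pos \<times> UNIV"
    using supp(3) by (fastforce simp: crossed_pairs_def crossed_supp_def)
qed

lemma crossed_supp_add: "crossed_supp (a + b) \<subseteq> crossed_supp a \<union> crossed_supp b"
  by (auto simp: crossed_supp_def)

lemma crossed_pairs_add: "crossed_pairs (a + b) \<subseteq> crossed_pairs a \<union> crossed_pairs b"
  by (auto simp: crossed_pairs_def)

lemma crossed_supp_smult: "crossed_supp (crossed_smult c a) \<subseteq> crossed_supp a"
  by (auto simp: crossed_supp_def crossed_smult_def fun_eq_iff)

lemma crossed_pairs_smult: "crossed_pairs (crossed_smult c a) \<subseteq> crossed_pairs a"
  by (auto simp: crossed_pairs_def crossed_smult_def fun_eq_iff)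

lemma crossed_alg_add:
  assumes "a \<in> crossed_alg" "b \<in> crossed_alg"
  shows "a + b \<in> crossed_alg"
proof -
  have "finite {k. (a + b) \<gamma> k \<noteq> 0}" for \<gamma>
  proof (rule finite_subset)
    show "{k. (a + b) \<gamma> k \<noteq> 0} \<subseteq> {k. a \<gamma> k \<noteq> 0} \<union> {k. b \<gamma> k \<noteq> 0}"
      by auto
    show "finite ({k. a \<gamma> k \<noteq> 0} \<union> {k. b \<gamma> k \<noteq> 0})"
      using assms by (simp add: crossed_alg_def modforms_graded_def)
  qed
  then show ?thesis
    using crossed_algD[OF assms(1)] crossed_algD[OF assms(2)] crossed_supp_add[of a b]
    by (auto simp: crossed_alg_def modforms_graded_def intro: modforms_add finite_subset)
qed

lemma crossed_alg_smult:
  assumes "a \<in> crossed_alg"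
  shows "crossed_smult c a \<in> crossed_alg"
proof -
  have "finite {k. crossed_smult c a \<gamma> k \<noteq> 0}" for \<gamma>
  proof (rule finite_subset)
    show "{k. crossed_smult c a \<gamma> k \<noteq> 0} \<subseteq> {k. a \<gamma> k \<noteq> 0}"
      by (auto simp: crossed_smult_def fun_eq_iff)
    show "finite {k. a \<gamma> k \<noteq> 0}"
      using assms by (simp add: crossed_alg_def modforms_graded_def)
  qed
  moreover have "crossed_smult c a \<gamma> k \<in> modforms k" for \<gamma> k
    using crossed_algD(1)[OF assms] by (simp add: crossed_smult_def modforms_scale)
  ultimately show ?thesis
    using crossed_algD(2,3)[OF assms] crossed_supp_smult[of c a]
    by (auto simp: crossed_alg_def modforms_graded_def intro: finite_subset)
qed

lemma crossed_alg_diff: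
  assumes "a \<in> crossed_alg" "b \<in> crossed_alg"
  shows "a - b \<in> crossed_alg"
proof -
  have "a - b = a + crossed_smult (-1) b"
    by (simp add: crossed_smult_def fun_eq_iff)
  then show ?thesis
    by (metis assms crossed_alg_add crossed_alg_smult)
qed

lemma crossed_supp_single: "crossed_supp (single \<gamma> k f) \<subseteq> {\<gamma>}"
  by (auto simp: crossed_supp_def single_def fun_eq_iff)

lemma crossed_pairs_single: "crossed_pairs (single \<gamma> k f) \<subseteq> {(\<gamma>, k)}"
  by (auto simp: crossed_pairs_def single_def split: if_splits)

lemma single_crossed_alg:
  assumes "\<gamma> \<in> GL2Q_pos" "f \<in> modforms k"
  shows "single \<gamma> k f \<in> crossed_alg"
proof -
  have "finite {j. single \<gamma> k f \<delta> j \<noteq> 0}" for \<delta>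
    by (rule finite_subset[of _ "{k}"]) (auto simp: single_def split: if_splits)
  moreover have "single \<gamma> k f \<delta> j \<in> modforms j" for \<delta> j
    using assms by (simp add: single_def modforms_zero)
  ultimately show ?thesis
    using crossed_supp_single[of \<gamma> k f] assms(1)
    by (auto simp: crossed_alg_def modforms_graded_def intro: finite_subset)
qed

lemma single_zero: "single \<gamma> k 0 = 0"
  by (simp add: single_def fun_eq_iff)

lemma zero_crossed_alg: "0 \<in> crossed_alg"
  using single_crossed_alg[OF one_GL2Q modforms_zero, of 0] by (simp add: single_zero)

lemma sum_crossed_apply: "(\<Sum>i\<in>I. P i) \<gamma> k = (\<Sum>i\<in>I. P i \<gamma> k)" for P :: "'i \<Rightarrow> crossed"
  by (induction I rule: infinite_finite_induct) auto

text \<open>Every element is a finite sum of homogeneous ones, so an additive statement needs to be checked only on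
homogeneous elements.\<close>

lemma crossed_alg_induct [consumes 1, case_names single add]:
  assumes "a \<in> crossed_alg"
    and single: "\<And>\<gamma> k f. \<gamma> \<in> GL2Q_pos \<Longrightarrow> f \<in> modforms k \<Longrightarrow> P (single \<gamma> k f)"
    and add: "\<And>a b. a \<in> crossed_alg \<Longrightarrow> b \<in> crossed_alg \<Longrightarrow> P a \<Longrightarrow> P b \<Longrightarrow> P (a + b)"
  shows "P a"
proof -
  have sub: "(\<Sum>(\<gamma>, k)\<in>T. single \<gamma> k (a \<gamma> k)) \<in> crossed_alg \<and> P (\<Sum>(\<gamma>, k)\<in>T. single \<gamma> k (a \<gamma> k))"
    if "finite T" "T \<subseteq> GL2Q_pos \<times> UNIV" for T
    using that
  proof (induction T rule: finite_induct)
    case empty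
    show ?case
      using single[OF one_GL2Q modforms_zero, of 0] zero_crossed_alg
      unfolding sum.empty single_zero by blast
  next
    case (insert p T)
    obtain \<gamma> k where p: "p = (\<gamma>, k)"
      by (cases p)
    define x where "x = (\<Sum>(\<gamma>, k)\<in>T. single \<gamma> k (a \<gamma> k))"
    have 1: "single \<gamma> k (a \<gamma> k) \<in> crossed_alg" "P (single \<gamma> k (a \<gamma> k))"
      using insert.prems crossed_algD(1)[OF assms(1)] by (auto simp: p intro: single_crossed_alg single)
    have 2: "x \<in> crossed_alg" "P x"
      using insert unfolding x_def by auto
    have 3: "(\<Sum>(\<gamma>, k)\<in>insert p T. single \<gamma> k (a \<gamma> k)) = single \<gamma> k (a \<gamma> k) + x"
      using sum.insert[OF insert.hyps(1,2), of "\<lambda>(\<gamma>, k). single \<gamma> k (a \<gamma> k)"]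
      by (simp only: p prod.case x_def)
    show ?case
      unfolding 3 using crossed_alg_add[OF 1(1) 2(1)] add[OF 1(1) 2(1) 1(2) 2(2)] by blast
  qed
  have "a = (\<Sum>(\<gamma>, k)\<in>crossed_pairs a. single \<gamma> k (a \<gamma> k))"
  proof (intro ext[of a])
    fix \<delta>
    show "a \<delta> = (\<Sum>(\<gamma>, k)\<in>crossed_pairs a. single \<gamma> k (a \<gamma> k)) \<delta>"
    proof
      fix j
      have "(\<Sum>(\<gamma>, k)\<in>crossed_pairs a. single \<gamma> k (a \<gamma> k)) \<delta> j
          = (\<Sum>p\<in>crossed_pairs a. if p = (\<delta>, j) then a \<delta> j else 0)"
        unfolding sum_crossed_apply by (intro sum.cong) (auto simp: single_def)
      also have "\<dots> = a \<delta> j"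
        using crossed_algD(4)[OF assms(1)] by (auto simp: crossed_pairs_def)
      finally show "a \<delta> j = (\<Sum>(\<gamma>, k)\<in>crossed_pairs a. single \<gamma> k (a \<gamma> k)) \<delta> j" ..
    qed
  qed
  then show ?thesis
    using sub[OF crossed_algD(4,5)[OF assms(1)]] by simp
qed

text \<open>The product is a sum over supports, which may shrink under addition. Summing over
arbitrary finite supersets makes additivity termwise.\<close>

lemma crossed_mult_eq:
  assumes "finite S" "finite T" "crossed_supp a \<subseteq> S" "crossed_supp b \<subseteq> T"
  shows "(a \<odot> b) \<gamma> k z = (\<Sum>(\<alpha>, \<beta>)\<in>{(\<alpha>, \<beta>) \<in> S \<times> T. \<alpha> ** \<beta> = \<gamma>}.
     \<Sum>(i, j)\<in>{(i, j). i + j = k}. a \<alpha> i z * slash j (b \<beta> j) (matrix_inv \<alpha>) z)"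
proof -
  let ?h = "\<lambda>(\<alpha>, \<beta>). \<Sum>(i, j)\<in>{(i, j). i + j = k}. a \<alpha> i z * slash j (b \<beta> j) (matrix_inv \<alpha>) z"
  let ?A = "{(\<alpha>, \<beta>) \<in> crossed_supp a \<times> crossed_supp b. \<alpha> ** \<beta> = \<gamma>}"
  let ?B = "{(\<alpha>, \<beta>) \<in> S \<times> T. \<alpha> ** \<beta> = \<gamma>}"
  have "?h p = 0" if p: "p \<in> ?B - ?A" for p
  proof -
    obtain \<alpha> \<beta> where [simp]: "p = (\<alpha>, \<beta>)"
      by (cases p)
    have "a \<alpha> = 0 \<or> b \<beta> = 0"
      using p by (auto simp: crossed_supp_def)
    then have "a \<alpha> i z * slash j (b \<beta> j) (matrix_inv \<alpha>) z = 0" for i j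
      by (auto simp: slash_zero)
    then show ?thesis
      by (auto intro!: sum.neutral)
  qed
  moreover have "finite ?B"
    using assms(1,2) by (auto intro: finite_subset[of _ "S \<times> T"])
  moreover have "?A \<subseteq> ?B"
    using assms(3,4) by auto
  ultimately have "sum ?h ?A = sum ?h ?B"
    by (intro sum.mono_neutral_left) blast+
  then show ?thesis
    unfolding crossed_mult_def .
qed

lemma crossed_mult_add_left:
  assumes "a \<in> crossed_alg" "a' \<in> crossed_alg" "b \<in> crossed_alg"
  shows "(a + a') \<odot> b = a \<odot> b + a' \<odot> b"
proof (intro ext)
  fix \<gamma> k z
  let ?S = "crossed_supp a \<union> crossed_supp a'" and ?T = "crossed_supp b"
  have fin: "finite ?S" "finite ?T"
    using crossed_algD(2) assms by auto
  show "((a + a') \<odot> b) \<gamma> k z = (a \<odot> b + a' \<odot> b) \<gamma> k z"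
    unfolding plus_fun_apply
      crossed_mult_eq[OF fin crossed_supp_add order_refl] crossed_mult_eq[OF fin Un_upper1 order_refl]
      crossed_mult_eq[OF fin Un_upper2 order_refl] sum.distrib[symmetric]
    by (intro sum.cong refl) (simp add: case_prod_unfold sum.distrib distrib_right)
qed

lemma crossed_mult_add_right:
  assumes "a \<in> crossed_alg" "b \<in> crossed_alg" "b' \<in> crossed_alg"
  shows "a \<odot> (b + b') = a \<odot> b + a \<odot> b'"
proof (intro ext)
  fix \<gamma> k z
  let ?S = "crossed_supp a" and ?T = "crossed_supp b \<union> crossed_supp b'"
  have fin: "finite ?S" "finite ?T"
    using crossed_algD(2) assms by auto
  show "(a \<odot> (b + b')) \<gamma> k z = (a \<odot> b + a \<odot> b') \<gamma> k z"
    unfolding plus_fun_apply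
      crossed_mult_eq[OF fin order_refl crossed_supp_add] crossed_mult_eq[OF fin order_refl Un_upper1]
      crossed_mult_eq[OF fin order_refl Un_upper2] sum.distrib[symmetric]
    by (intro sum.cong refl)
      (simp add: case_prod_unfold sum.distrib slash_add[unfolded plus_fun_def] distrib_left)
qed

lemma crossed_mult_smult_left:
  assumes "a \<in> crossed_alg" "b \<in> crossed_alg"
  shows "crossed_smult c a \<odot> b = crossed_smult c (a \<odot> b)"
proof (intro ext)
  fix \<gamma> k z
  have fin: "finite (crossed_supp a)" "finite (crossed_supp b)"
    using crossed_algD(2) assms by auto
  show "(crossed_smult c a \<odot> b) \<gamma> k z = crossed_smult c (a \<odot> b) \<gamma> k z"
    unfolding crossed_mult_eq[OF fin crossed_supp_smult order_refl]
    unfolding crossed_smult_def crossed_mult_eq[OF fin order_refl order_refl] sum_distrib_left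
    by (intro sum.cong refl) (simp add: case_prod_unfold sum_distrib_left mult.assoc)
qed

lemma crossed_mult_smult_right:
  assumes "a \<in> crossed_alg" "b \<in> crossed_alg"
  shows "a \<odot> crossed_smult c b = crossed_smult c (a \<odot> b)"
proof (intro ext)
  fix \<gamma> k z
  have fin: "finite (crossed_supp a)" "finite (crossed_supp b)"
    using crossed_algD(2) assms by auto
  show "(a \<odot> crossed_smult c b) \<gamma> k z = crossed_smult c (a \<odot> b) \<gamma> k z"
    unfolding crossed_mult_eq[OF fin order_refl crossed_supp_smult]
    unfolding crossed_smult_def slash_scale crossed_mult_eq[OF fin order_refl order_refl] sum_distrib_left
    by (intro sum.cong refl) (simp add: case_prod_unfold sum_distrib_left mult.left_commute)
qed

text \<open>This is the defining rule \<open>(f U\<^bsub>\<alpha>\<^esub>) (g U\<^bsub>\<beta>\<^esub>) = f (g|\<alpha>\<^sup>-\<^sup>1) U\<^bsub>\<alpha>\<beta>\<^esub>\<close>.\<close>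

lemma crossed_mult_single:
  "single \<alpha> i f \<odot> single \<beta> j g = single (\<alpha> ** \<beta>) (i + j) (f * slash j g (matrix_inv \<alpha>))"
proof (intro ext)
  fix \<gamma> k z
  let ?h = "\<lambda>i' j'. single \<alpha> i f \<alpha> i' z * slash j' (single \<beta> j g \<beta> j') (matrix_inv \<alpha>) z"
  have h: "?h i' j' = (if i' = i \<and> j' = j then f z * slash j g (matrix_inv \<alpha>) z else 0)" for i' j'
    by (simp add: single_def slash_zero)
  have "(\<Sum>(i', j')\<in>{(i', j'). i' + j' = k}. ?h i' j')
      = (\<Sum>p\<in>{(i', j'). i' + j' = k}. if p = (i, j) then f z * slash j g (matrix_inv \<alpha>) z else 0)"
    unfolding h by (intro sum.cong) (auto split: if_splits)
  also have "\<dots> = (if i + j = k then f z * slash j g (matrix_inv \<alpha>) z else 0)"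
  proof -
    have "finite {(i', j'). i' + j' = k}"
      by (rule finite_subset[of _ "{..k} \<times> {..k}"]) auto
    then show ?thesis
      by simp
  qed
  finally have inner: "(\<Sum>(i', j')\<in>{(i', j'). i' + j' = k}. ?h i' j')
      = (if i + j = k then f z * slash j g (matrix_inv \<alpha>) z else 0)" .
  have "{(\<alpha>', \<beta>') \<in> {\<alpha>} \<times> {\<beta>}. \<alpha>' ** \<beta>' = \<gamma>} = (if \<alpha> ** \<beta> = \<gamma> then {(\<alpha>, \<beta>)} else {})"
    by auto
  then have "(single \<alpha> i f \<odot> single \<beta> j g) \<gamma> k z
      = (if \<alpha> ** \<beta> = \<gamma> then \<Sum>(i', j')\<in>{(i', j'). i' + j' = k}. ?h i' j' else 0)"
    using crossed_mult_eq[OF _ _ crossed_supp_single[of \<alpha> i f] crossed_supp_single[of \<beta> j g], of \<gamma> k z]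
    by simp
  then show "(single \<alpha> i f \<odot> single \<beta> j g) \<gamma> k z
      = single (\<alpha> ** \<beta>) (i + j) (f * slash j g (matrix_inv \<alpha>)) \<gamma> k z"
    unfolding inner by (auto simp: single_def)
qed

lemma single_mult_form:
  assumes "\<alpha> \<in> GL2Q_pos" "f \<in> modforms i" "g \<in> modforms j"
  shows "f * slash j g (matrix_inv \<alpha>) \<in> modforms (i + j)"
  by (intro modforms_mult modforms_slash inv_GL2Q assms)

lemma crossed_mult_alg:
  assumes "a \<in> crossed_alg" "b \<in> crossed_alg"
  shows "a \<odot> b \<in> crossed_alg"
  using assms(1)
proof (induction a rule: crossed_alg_induct)
  case (single \<alpha> i f)
  note f = single
  from assms(2) show ?case
  proof (induction b rule: crossed_alg_induct)
    case (single \<beta> j g)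
    then show ?case
      unfolding crossed_mult_single using f
      by (intro single_crossed_alg mult_GL2Q single_mult_form)
  next
    case (add b b')
    have "single \<alpha> i f \<odot> (b + b') = single \<alpha> i f \<odot> b + single \<alpha> i f \<odot> b'"
      using crossed_mult_add_right[OF single_crossed_alg[OF f] add(1,2)] .
    then show ?case
      using crossed_alg_add[OF add(3,4)] by metis
  qed
next
  case (add a a')
  then show ?case
    using crossed_mult_add_left[OF add(1,2) assms(2)] crossed_alg_add[OF add(3,4)] by metis
qed

lemma crossed_mult_diff_right:
  assumes "a \<in> crossed_alg" "b \<in> crossed_alg" "c \<in> crossed_alg"
  shows "a \<odot> (b - c) = a \<odot> b - a \<odot> c"
  using crossed_mult_add_right[OF assms(1) crossed_alg_diff[OF assms(2,3)] assms(3)] by simp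

lemma crossed_supp_mult:
  assumes "crossed_supp a \<subseteq> {\<alpha>}" "crossed_supp b \<subseteq> {\<beta>}"
  shows "crossed_supp (a \<odot> b) \<subseteq> {\<alpha> ** \<beta>}"
proof
  fix \<gamma> assume \<gamma>: "\<gamma> \<in> crossed_supp (a \<odot> b)"
  show "\<gamma> \<in> {\<alpha> ** \<beta>}"
  proof (rule ccontr)
    assume "\<gamma> \<notin> {\<alpha> ** \<beta>}"
    then have "{(\<alpha>', \<beta>') \<in> {\<alpha>} \<times> {\<beta>}. \<alpha>' ** \<beta>' = \<gamma>} = {}"
      by auto
    then have "(a \<odot> b) \<gamma> k z = 0" for k z
      using crossed_mult_eq[OF _ _ assms, of \<gamma> k z]
      by (simp only: sum.empty finite.emptyI finite.insertI)
    then have "(a \<odot> b) \<gamma> = 0"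
      by (simp add: fun_eq_iff)
    with \<gamma> show False
      by (simp add: crossed_supp_def)
  qed
qed

lemma form_embed_single: "form_embed k f = single (mat 1) k f"
  by (simp add: form_embed_def single_def fun_eq_iff)

lemma one_modforms: "(\<lambda>z. if Im z > 0 then 1 else 0) \<in> modforms 0"
proof (rule modformsI)
  define e where "e = (\<lambda>z::complex. if Im z > 0 then 1 else 0 :: complex)"
  have inv: "slash 0 e \<gamma> = e" if "\<gamma> \<in> GL2Q_pos" for \<gamma>
  proof
    fix z
    have "det \<gamma> > 0"
      using that by (simp add: GL2Q_pos_def)
    moreover have "Im (moeb \<gamma> z) > 0 \<longleftrightarrow> Im z > 0"
      using Im_moeb_pos[OF that, of z] Im_moeb_nonpos[OF that, of z] by linarith
    ultimately show "slash 0 e \<gamma> z = e z"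
      by (simp add: slash_def e_def)
  qed
  have "q_expansion 1 e (\<lambda>n. if n = 0 then 1 else 0)"
    unfolding q_expansion_iff_powers e_def by (auto intro: powser_sums_if[of 0, simplified] simp: sums_If_finite_set)
  then have "\<exists>a. q_expansion 1 (slash 0 e \<gamma>) a" if "\<gamma> \<in> SL2Z" for \<gamma>
    using inv[OF Gamma_level_GL2Q[OF that]] by auto
  moreover have "e holomorphic_on {z. Im z > 0}"
    by (rule holomorphic_transform[of "\<lambda>_. 1"]) (auto simp: e_def)
  ultimately show "(\<lambda>z. if Im z > 0 then 1 else 0) \<in> modforms_level 0 1"
    unfolding e_def[symmetric] modforms_level_def using inv[OF Gamma_level_GL2Q]
    by (auto simp: e_def)
qed simp

lemma crossed_one_alg: "crossed_one \<in> crossed_alg"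
  unfolding crossed_one_def form_embed_single by (intro single_crossed_alg one_GL2Q one_modforms)

section \<open>The bilinear map of a period cocycle\<close>

text \<open>The operator \<^const>\<open>twist_last\<close> written for a function of the last argument alone, which is the form in which
additivity can be stated and used.\<close>

definition twisted_sum :: "nat \<Rightarrow> (crossed \<Rightarrow> bipoly) \<Rightarrow> crossed \<Rightarrow> bipoly" where
  "twisted_sum r \<Phi> a = (\<Sum>\<gamma>\<in>crossed_supp a. poly_act r (matrix_inv \<gamma>) (\<Phi> (crossed_comp \<gamma> a)))"

definition crossed_additive :: "(crossed \<Rightarrow> 'a::ab_group_add) \<Rightarrow> bool" where
  "crossed_additive \<Phi> \<longleftrightarrow> (\<forall>x\<in>crossed_alg. \<forall>y\<in>crossed_alg. \<Phi> (x + y) = \<Phi> x + \<Phi> y)"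

lemma crossed_additive_zero: "crossed_additive \<Phi> \<Longrightarrow> \<Phi> 0 = 0"
  unfolding crossed_additive_def using zero_crossed_alg by (metis add.right_neutral add_left_cancel)

lemma crossed_additiveI:
  "(\<And>x y. x \<in> crossed_alg \<Longrightarrow> y \<in> crossed_alg \<Longrightarrow> \<Phi> (x + y) = \<Phi> x + \<Phi> y) \<Longrightarrow> crossed_additive \<Phi>"
  by (simp add: crossed_additive_def)

lemma crossed_additive_eqI:
  assumes "crossed_additive \<Phi>" "crossed_additive \<Psi>" "a \<in> crossed_alg"
    and "\<And>\<gamma> k f. \<gamma> \<in> GL2Q_pos \<Longrightarrow> f \<in> modforms k \<Longrightarrow> \<Phi> (single \<gamma> k f) = \<Psi> (single \<gamma> k f)"
  shows "\<Phi> a = \<Psi> a"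
  using assms(3)
proof (induction a rule: crossed_alg_induct)
  case (single \<gamma> k f)
  then show ?case
    by (rule assms(4))
next
  case (add a b)
  then show ?case
    using assms(1,2) unfolding crossed_additive_def by metis
qed

lemma crossed_comp_alg:
  assumes "a \<in> crossed_alg"
  shows "crossed_comp \<gamma> a \<in> crossed_alg"
proof -
  have "crossed_supp (crossed_comp \<gamma> a) \<subseteq> crossed_supp a"
    by (auto simp: crossed_supp_def crossed_comp_def split: if_splits)
  moreover have "crossed_comp \<gamma> a \<delta> \<in> modforms_graded" for \<delta>
    using assms zero_crossed_alg by (auto simp: crossed_alg_def crossed_comp_def)
  ultimately show ?thesis
    using crossed_algD(2,3)[OF assms] by (auto simp: crossed_alg_def intro: finite_subset)
qed

lemma twisted_sum_eq:
  assumes "finite S" "crossed_supp a \<subseteq> S" "\<Phi> 0 = 0"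
  shows "twisted_sum r \<Phi> a = (\<Sum>\<gamma>\<in>S. poly_act r (matrix_inv \<gamma>) (\<Phi> (crossed_comp \<gamma> a)))"
  unfolding twisted_sum_def
proof (rule sum.mono_neutral_left[OF assms(1,2)], rule ballI)
  fix \<gamma> assume "\<gamma> \<in> S - crossed_supp a"
  then have "crossed_comp \<gamma> a = 0"
    by (simp add: crossed_comp_def crossed_supp_def fun_eq_iff)
  then show "poly_act r (matrix_inv \<gamma>) (\<Phi> (crossed_comp \<gamma> a)) = 0"
    by (metis assms(3) poly_act_zero)
qed

lemma twisted_sum_additive:
  assumes "crossed_additive \<Phi>"
  shows "crossed_additive (twisted_sum r \<Phi>)"
  unfolding crossed_additive_def
proof (intro ballI)
  fix a b assume ab: "a \<in> crossed_alg" "b \<in> crossed_alg"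
  let ?S = "crossed_supp a \<union> crossed_supp b"
  have fin: "finite ?S"
    using crossed_algD(2) ab by auto
  have zero: "\<Phi> 0 = 0"
    using assms by (rule crossed_additive_zero)
  have "\<Phi> (crossed_comp \<gamma> (a + b)) = \<Phi> (crossed_comp \<gamma> a) + \<Phi> (crossed_comp \<gamma> b)" for \<gamma>
  proof -
    have "crossed_comp \<gamma> (a + b) = crossed_comp \<gamma> a + crossed_comp \<gamma> b"
      by (simp add: crossed_comp_def fun_eq_iff)
    then show ?thesis
      using assms crossed_comp_alg ab unfolding crossed_additive_def by metis
  qed
  then show "twisted_sum r \<Phi> (a + b) = twisted_sum r \<Phi> a + twisted_sum r \<Phi> b"
    unfolding twisted_sum_eq[where \<Phi> = \<Phi>, OF fin crossed_supp_add zero] twisted_sum_eq[where \<Phi> = \<Phi>, OF fin Un_upper1 zero]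
      twisted_sum_eq[where \<Phi> = \<Phi>, OF fin Un_upper2 zero] sum.distrib[symmetric]
    by (simp only: poly_act_add)
qed

lemma twisted_sum_add_fun:
  assumes "a \<in> crossed_alg" "\<And>x. x \<in> crossed_alg \<Longrightarrow> \<Phi> x = \<Phi>1 x + \<Phi>2 x"
  shows "twisted_sum r \<Phi> a = twisted_sum r \<Phi>1 a + twisted_sum r \<Phi>2 a"
  unfolding twisted_sum_def assms(2)[OF crossed_comp_alg[OF assms(1)]] poly_act_add sum.distrib ..

lemma twisted_sum_single:
  assumes "\<Phi> 0 = 0"
  shows "twisted_sum r \<Phi> (single \<gamma> k f) = poly_act r (matrix_inv \<gamma>) (\<Phi> (single \<gamma> k f))"
proof -
  have "crossed_comp \<gamma> (single \<gamma> k f) = single \<gamma> k f"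
    by (simp add: crossed_comp_def single_def fun_eq_iff)
  then show ?thesis
    using twisted_sum_eq[where \<Phi> = \<Phi>, OF _ crossed_supp_single[of \<gamma> k f] assms] by simp
qed

context period_cocycle
begin

abbreviation pairing :: "crossed \<Rightarrow> crossed \<Rightarrow> bipoly" where
  "pairing \<equiv> bilin_ext m K"

definition pair_term :: "crossed \<Rightarrow> crossed \<Rightarrow> (rat^2^2) \<times> nat \<Rightarrow> (rat^2^2) \<times> nat \<Rightarrow> bipoly" where
  "pair_term a b p q = (if snd p + snd q = m \<and> fst p ** fst q = mat 1
     then K (fst p) (a (fst p) (snd p) * slash (snd q) (b (fst q) (snd q)) (fst q)) else 0)"

lemma bilin_ext_pair_term: "pairing a b = (\<Sum>p\<in>crossed_pairs a. \<Sum>q\<in>crossed_pairs b. pair_term a b p q)"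
  unfolding bilin_ext_def crossed_pairs_def pair_term_def case_prod_unfold ..

text \<open>As for products, finite supersets of the supports remove the dependence of the index sets on the
arguments; the additional terms vanish because \<open>K \<gamma> 0 = 0\<close>.\<close>

lemma bilin_ext_eq:
  assumes "finite S" "finite R" "S \<subseteq> GL2Q_pos \<times> UNIV" "crossed_pairs a \<subseteq> S" "crossed_pairs b \<subseteq> R"
  shows "pairing a b = (\<Sum>p\<in>S. \<Sum>q\<in>R. pair_term a b p q)"
proof -
  have right: "pair_term a b p q = 0" if "p \<in> S" "q \<notin> crossed_pairs b" for p q
  proof -
    have "b (fst q) (snd q) = 0"
      using that(2) by (auto simp: crossed_pairs_def)
    moreover have "K (fst p) 0 = 0"
      using that(1) assms(3) by (intro K_zero) auto
    ultimately show ?thesis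
      by (simp add: pair_term_def slash_zero)
  qed
  have left: "pair_term a b p q = 0" if "p \<in> S - crossed_pairs a" for p q
  proof -
    have "a (fst p) (snd p) = 0"
      using that by (auto simp: crossed_pairs_def)
    moreover have "K (fst p) 0 = 0"
      using that assms(3) by (intro K_zero) auto
    ultimately show ?thesis
      by (simp add: pair_term_def)
  qed
  have "pairing a b = (\<Sum>p\<in>crossed_pairs a. \<Sum>q\<in>R. pair_term a b p q)"
    unfolding bilin_ext_pair_term
    by (intro sum.cong refl sum.mono_neutral_left) (use assms right in auto)
  also have "\<dots> = (\<Sum>p\<in>S. \<Sum>q\<in>R. pair_term a b p q)"
    by (intro sum.mono_neutral_left) (use assms left in auto)
  finally show ?thesis .
qed

lemma pairing_modforms:
  assumes "a \<in> crossed_alg" "b \<in> crossed_alg" "\<gamma> \<in> GL2Q_pos" "i + j = m"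
  shows "a \<delta> i * slash j (b \<epsilon> j) \<gamma> \<in> modforms m"
  using modforms_mult[OF crossed_algD(1)[OF assms(1)] modforms_slash[OF crossed_algD(1)[OF assms(2)] assms(3)]]
  assms(4) by metis

lemma pair_term_add_left:
  assumes "a \<in> crossed_alg" "a' \<in> crossed_alg" "b \<in> crossed_alg" "fst p \<in> GL2Q_pos" "fst q \<in> GL2Q_pos"
  shows "pair_term (a + a') b p q = pair_term a b p q + pair_term a' b p q"
  using K_add[OF assms(4) pairing_modforms[OF assms(1,3,5)] pairing_modforms[OF assms(2,3,5)]]
  by (simp add: pair_term_def distrib_right)

lemma pair_term_add_right:
  assumes "a \<in> crossed_alg" "b \<in> crossed_alg" "b' \<in> crossed_alg" "fst p \<in> GL2Q_pos" "fst q \<in> GL2Q_pos"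
  shows "pair_term a (b + b') p q = pair_term a b p q + pair_term a b' p q"
  using K_add[OF assms(4) pairing_modforms[OF assms(1,2,5)] pairing_modforms[OF assms(1,3,5)]]
  by (simp add: pair_term_def distrib_left slash_add)

lemma pairing_add_left:
  assumes "a \<in> crossed_alg" "a' \<in> crossed_alg" "b \<in> crossed_alg"
  shows "pairing (a + a') b = pairing a b + pairing a' b"
proof -
  let ?S = "crossed_pairs a \<union> crossed_pairs a'" and ?R = "crossed_pairs b"
  note D = crossed_algD(4,5)
  have fin: "finite ?S" "finite ?R" "?S \<subseteq> GL2Q_pos \<times> UNIV"
    using D[OF assms(1)] D[OF assms(2)] D[OF assms(3)] by auto
  have pq: "fst p \<in> GL2Q_pos" "fst q \<in> GL2Q_pos" if "p \<in> ?S" "q \<in> ?R" for p q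
    using that fin(3) D(2)[OF assms(3)] by auto
  show ?thesis
    unfolding bilin_ext_eq[OF fin crossed_pairs_add order_refl] bilin_ext_eq[OF fin Un_upper1 order_refl]
      bilin_ext_eq[OF fin Un_upper2 order_refl] sum.distrib[symmetric]
    by (intro sum.cong refl pair_term_add_left assms pq)
qed

lemma pairing_add_right:
  assumes "a \<in> crossed_alg" "b \<in> crossed_alg" "b' \<in> crossed_alg"
  shows "pairing a (b + b') = pairing a b + pairing a b'"
proof -
  let ?S = "crossed_pairs a" and ?R = "crossed_pairs b \<union> crossed_pairs b'"
  note D = crossed_algD(4,5)
  have fin: "finite ?S" "finite ?R" "?S \<subseteq> GL2Q_pos \<times> UNIV"
    using D[OF assms(1)] D[OF assms(2)] D[OF assms(3)] by auto
  have pq: "fst p \<in> GL2Q_pos" "fst q \<in> GL2Q_pos" if "p \<in> ?S" "q \<in> ?R" for p q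
    using that fin(3) D(2)[OF assms(2)] D(2)[OF assms(3)] by auto
  show ?thesis
    unfolding bilin_ext_eq[OF fin order_refl crossed_pairs_add] bilin_ext_eq[OF fin order_refl Un_upper1]
      bilin_ext_eq[OF fin order_refl Un_upper2] sum.distrib[symmetric]
    by (intro sum.cong refl pair_term_add_right assms pq)
qed

lemma pair_term_smult_left:
  assumes "a \<in> crossed_alg" "b \<in> crossed_alg" "fst p \<in> GL2Q_pos" "fst q \<in> GL2Q_pos"
  shows "pair_term (crossed_smult c a) b p q T1 T2 = c * pair_term a b p q T1 T2"
  using K_scale[OF assms(3) pairing_modforms[OF assms(1,2,4)], of "snd p" "snd q" c]
  by (simp add: pair_term_def crossed_smult_def times_fun_def mult.assoc)

lemma pair_term_smult_right:
  assumes "a \<in> crossed_alg" "b \<in> crossed_alg" "fst p \<in> GL2Q_pos" "fst q \<in> GL2Q_pos"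
  shows "pair_term a (crossed_smult c b) p q T1 T2 = c * pair_term a b p q T1 T2"
  using K_scale[OF assms(3) pairing_modforms[OF assms(1,2,4)], of "snd p" "snd q" c]
  by (simp add: pair_term_def crossed_smult_def slash_scale times_fun_def mult.left_commute)

lemma pairing_smult:
  assumes "a \<in> crossed_alg" "b \<in> crossed_alg"
  shows pairing_smult_left: "pairing (crossed_smult c a) b T1 T2 = c * pairing a b T1 T2"
    and pairing_smult_right: "pairing a (crossed_smult c b) T1 T2 = c * pairing a b T1 T2"
proof -
  let ?S = "crossed_pairs a" and ?R = "crossed_pairs b"
  note D = crossed_algD(4,5)
  have fin: "finite ?S" "finite ?R" "?S \<subseteq> GL2Q_pos \<times> UNIV"
    using D[OF assms(1)] D[OF assms(2)] by auto
  have pq: "fst p \<in> GL2Q_pos" "fst q \<in> GL2Q_pos" if "p \<in> ?S" "q \<in> ?R" for p q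
    using that fin(3) D(2)[OF assms(2)] by auto
  show "pairing (crossed_smult c a) b T1 T2 = c * pairing a b T1 T2"
    unfolding bilin_ext_eq[OF fin crossed_pairs_smult order_refl] bilin_ext_eq[OF fin order_refl order_refl]
      sum_bipoly_apply sum_distrib_left
    by (intro sum.cong refl pair_term_smult_left assms pq)
  show "pairing a (crossed_smult c b) T1 T2 = c * pairing a b T1 T2"
    unfolding bilin_ext_eq[OF fin order_refl crossed_pairs_smult] bilin_ext_eq[OF fin order_refl order_refl]
      sum_bipoly_apply sum_distrib_left
    by (intro sum.cong refl pair_term_smult_right assms pq)
qed

lemma pairing_diff_left:
  assumes "a \<in> crossed_alg" "a' \<in> crossed_alg" "b \<in> crossed_alg"
  shows "pairing (a - a') b = pairing a b - pairing a' b"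
  using pairing_add_left[OF crossed_alg_diff[OF assms(1,2)] assms(2,3)] by simp

lemma pairing_hom:
  assumes "a \<in> crossed_alg" "b \<in> crossed_alg"
  shows "pairing a b \<in> hom_polys (m - 2)"
  unfolding bilin_ext_pair_term
proof (intro hom_polys_sum)
  fix p q assume "p \<in> crossed_pairs a" "q \<in> crossed_pairs b"
  then have "fst p \<in> GL2Q_pos" "fst q \<in> GL2Q_pos"
    using crossed_algD(5) assms by fastforce+
  then show "pair_term a b p q \<in> hom_polys (m - 2)"
    using K_hom[OF _ pairing_modforms[OF assms]] by (simp add: pair_term_def hom_polys_zero)
qed

lemma pairing_single:
  assumes "\<alpha> \<in> GL2Q_pos"
  shows "pairing (single \<alpha> i f) (single \<beta> j g) = (if i + j = m \<and> \<alpha> ** \<beta> = mat 1 then K \<alpha> (f * slash j g \<beta>) else 0)"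
proof -
  have "pairing (single \<alpha> i f) (single \<beta> j g) = pair_term (single \<alpha> i f) (single \<beta> j g) (\<alpha>, i) (\<beta>, j)"
    using bilin_ext_eq[OF _ _ _ crossed_pairs_single[of \<alpha> i f] crossed_pairs_single[of \<beta> j g]] assms by simp
  then show ?thesis
    by (simp add: pair_term_def single_def)
qed

lemma pairing_supp:
  assumes "crossed_supp a \<subseteq> {\<alpha>}" "crossed_supp b \<subseteq> {\<beta>}" "\<alpha> ** \<beta> \<noteq> mat 1"
  shows "pairing a b = 0"
  unfolding bilin_ext_pair_term
proof (intro sum.neutral ballI)
  fix p q assume "p \<in> crossed_pairs a" "q \<in> crossed_pairs b"
  then have "fst p \<in> crossed_supp a" "fst q \<in> crossed_supp b"
    by (auto simp: crossed_pairs_def crossed_supp_def)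
  then have "fst p = \<alpha>" "fst q = \<beta>"
    using assms by auto
  then show "pair_term a b p q = 0"
    using assms(3) by (simp add: pair_term_def)
qed

text \<open>If one argument is supported at \<open>1\<close>, then so is the relevant part of the other, and only the kernel
at \<open>1\<close> is evaluated.\<close>

lemma pairing_supp_one:
  assumes "a \<in> crossed_alg" "b \<in> crossed_alg" "crossed_supp a \<subseteq> {mat 1} \<or> crossed_supp b \<subseteq> {mat 1}"
  shows "pairing a b = 0"
  unfolding bilin_ext_pair_term
proof (intro sum.neutral ballI)
  fix p q assume pq: "p \<in> crossed_pairs a" "q \<in> crossed_pairs b"
  then have supp: "fst p \<in> crossed_supp a" "fst q \<in> crossed_supp b"
    by (auto simp: crossed_pairs_def crossed_supp_def)
  show "pair_term a b p q = 0"
  proof (cases "snd p + snd q = m \<and> fst p ** fst q = mat 1")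
    case True
    then have "fst p = mat 1"
      using assms(3) supp by auto
    moreover have "fst q \<in> GL2Q_pos"
      using crossed_algD(3)[OF assms(2)] supp by auto
    ultimately show ?thesis
      using True K_one[OF pairing_modforms[OF assms(1,2)]] by (simp add: pair_term_def)
  next
    case False
    then show ?thesis
      unfolding pair_term_def by (rule if_not_P)
  qed
qed

end

section \<open>The cochains gv and tgv\<close>

lemma tuples_cases:
  "as \<in> tuples 0 \<Longrightarrow> \<exists>a0\<in>crossed_alg. as = [a0]"
  "as \<in> tuples 1 \<Longrightarrow> \<exists>a0\<in>crossed_alg. \<exists>a1\<in>crossed_alg. as = [a0, a1]"
  "as \<in> tuples 2 \<Longrightarrow> \<exists>a0\<in>crossed_alg. \<exists>a1\<in>crossed_alg. \<exists>a2\<in>crossed_alg. as = [a0, a1, a2]"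
  by (auto simp: tuples_def length_Suc_conv numeral_2_eq_2)

lemma coch_b_tgv:
  "coch_b r 1 (tgv \<tau> w) [a0, a1, a2] =
    - \<tau> (a0 \<odot> a1) (w \<odot> a2) + \<tau> a0 (w \<odot> (a1 \<odot> a2)) + twisted_sum r (\<lambda>x. - \<tau> (x \<odot> a0) (w \<odot> a1)) a2"
  by (simp add: fun_eq_iff coch_b_def tgv_def twist_last_def twisted_sum_def)

lemma coch_B_tgv:
  "coch_B r 1 (tgv \<tau> w) [a] = - \<tau> crossed_one (w \<odot> a) - \<tau> a (w \<odot> crossed_one)"
  by (simp add: fun_eq_iff coch_B_def coch_B0_def tgv_def)

lemma mat_mult_rotate:
  assumes "\<alpha> \<in> GL2Q_pos" "\<beta> \<in> GL2Q_pos" "\<gamma> \<in> GL2Q_pos"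
  shows "\<gamma> ** \<alpha> ** \<beta> = mat 1 \<longleftrightarrow> \<alpha> ** \<beta> ** \<gamma> = mat 1"
  using matrix_left_right_inverse[of \<gamma> "\<alpha> ** \<beta>"] by (simp add: matrix_mul_assoc)

context period_cocycle
begin

text \<open>With \<open>\<gamma>\<^sup>-\<^sup>1 = \<delta> = \<alpha>\<beta>\<close> and \<open>g = f0 (f1|\<alpha>\<^sup>-\<^sup>1) (f2|\<gamma>)\<close>, the three terms are \<open>K \<delta> g\<close>, \<open>K \<alpha> g\<close> and
\<open>\<delta> \<cdot> K (\<delta>\<^sup>-\<^sup>1\<alpha>) (g|\<delta>)\<close>, which is the cocycle relation for \<open>\<alpha> = \<delta> (\<delta>\<^sup>-\<^sup>1\<alpha>)\<close>.\<close>

lemma pairing_cocycle_single: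
  assumes G: "\<alpha> \<in> GL2Q_pos" "\<beta> \<in> GL2Q_pos" "\<gamma> \<in> GL2Q_pos"
    and M: "f0 \<in> modforms k0" "f1 \<in> modforms k1" "f2 \<in> modforms k2"
    and b: "b = single \<alpha> k0 f0" "c = single \<beta> k1 f1" "d = single \<gamma> k2 f2"
  shows "pairing (b \<odot> c) d - pairing b (c \<odot> d) + poly_act (m - 2) (matrix_inv \<gamma>) (pairing (d \<odot> b) c) = 0"
proof (cases "k0 + k1 + k2 = m \<and> \<alpha> ** \<beta> ** \<gamma> = mat 1")
  case False
  then have "pairing (b \<odot> c) d = 0" "pairing b (c \<odot> d) = 0" "pairing (d \<odot> b) c = 0"
    using mat_mult_rotate[OF G] G
    by (auto simp: b crossed_mult_single pairing_single mult_GL2Q matrix_mul_assoc)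
  then show ?thesis
    by (simp add: poly_act_zero)
next
  case True
  then have m: "k0 + k1 + k2 = m" and one: "\<alpha> ** \<beta> ** \<gamma> = mat 1"
    by auto
  define \<delta> where "\<delta> = \<alpha> ** \<beta>"
  have \<delta>: "\<delta> \<in> GL2Q_pos" "matrix_inv \<gamma> = \<delta>" "matrix_inv \<delta> = \<gamma>"
    using G one mat_mult_eq_one_iff[of \<delta> \<gamma>] mat_inv_inv[of \<delta>] by (auto simp: \<delta>_def mult_GL2Q)
  have \<gamma>: "\<gamma> = matrix_inv \<beta> ** matrix_inv \<alpha>"
    using \<delta>(3) mat_inv_mult[OF G(1,2)] by (simp add: \<delta>_def)
  have \<beta>\<gamma>: "\<beta> ** \<gamma> = matrix_inv \<alpha>"
    using one mat_mult_eq_one_iff[OF G(1), of "\<beta> ** \<gamma>"] by (simp add: matrix_mul_assoc)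
  have \<alpha>\<delta>: "matrix_inv \<alpha> ** \<delta> = \<beta>"
    by (simp add: \<delta>_def matrix_mul_assoc mat_inv_left[OF G(1)])
  have \<gamma>\<delta>: "\<gamma> ** \<delta> = mat 1" "\<delta> ** \<gamma> = mat 1"
    using \<delta> mat_inv_left[OF \<delta>(1)] mat_inv_right[OF \<delta>(1)] by auto
  note off = modforms_off_H[OF M(1)] modforms_off_H[OF M(2)] modforms_off_H[OF M(3)]
  define g where "g = f0 * slash k1 f1 (matrix_inv \<alpha>) * slash k2 f2 \<gamma>"
  have g: "g \<in> modforms m"
    unfolding g_def m[symmetric] by (intro modforms_mult modforms_slash inv_GL2Q G M)
  have "pairing (b \<odot> c) d = K \<delta> g"
    using m one by (simp add: b crossed_mult_single pairing_single mult_GL2Q G g_def \<delta>_def)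
  moreover have "pairing b (c \<odot> d) = K \<alpha> g"
  proof -
    have "slash (k1 + k2) (f1 * slash k2 f2 (matrix_inv \<beta>)) (\<beta> ** \<gamma>)
        = slash k1 f1 (matrix_inv \<alpha>) * slash k2 f2 \<gamma>"
      unfolding \<beta>\<gamma> slash_mult
        slash_slash[OF inv_GL2Q[OF G(2)] inv_GL2Q[OF G(1)] off(3)] \<gamma>[symmetric] ..
    then show ?thesis
      using m one by (simp add: b crossed_mult_single pairing_single G g_def matrix_mul_assoc mult.assoc add.assoc)
  qed
  moreover have "pairing (d \<odot> b) c = K (\<gamma> ** \<alpha>) (slash m g \<delta>)"
  proof -
    have "slash m g \<delta> = slash k0 f0 \<delta> * slash k1 f1 \<beta> * f2"
      unfolding g_def m[symmetric] slash_mult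
        slash_slash[OF inv_GL2Q[OF G(1)] \<delta>(1) off(2)] slash_slash[OF G(3) \<delta>(1) off(3)]
        \<alpha>\<delta> \<gamma>\<delta> slash_one ..
    then have "f2 * slash k0 f0 (matrix_inv \<gamma>) * slash k1 f1 \<beta> = slash m g \<delta>"
      by (simp add: \<delta>(2) mult_ac)
    then show ?thesis
      using m one mat_mult_rotate[OF G] by (simp add: b crossed_mult_single pairing_single G mult_GL2Q)
  qed
  moreover have "K \<alpha> g = K \<delta> g + poly_act (m - 2) \<delta> (K (\<gamma> ** \<alpha>) (slash m g \<delta>))"
  proof -
    have "\<delta> ** (\<gamma> ** \<alpha>) = \<alpha>"
      by (simp add: matrix_mul_assoc \<gamma>\<delta>)
    then show ?thesis
      using K_cocycle[OF \<delta>(1) mult_GL2Q[OF G(3,1)] g] by simp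
  qed
  ultimately show ?thesis
    by (simp add: \<delta>(2))
qed

text \<open>On homogeneous elements both sides evaluate the kernel at the same form, because \<open>\<beta> = \<alpha>\<^sup>-\<^sup>1\<close> whenever
the value is nonzero.\<close>

lemma pairing_move_form:
  assumes "b \<in> crossed_alg" "d \<in> crossed_alg" "\<omega> \<in> modforms k"
  shows "pairing (b \<odot> single (mat 1) k \<omega>) d = pairing b (single (mat 1) k \<omega> \<odot> d)"
proof -
  let ?w = "single (mat 1) k \<omega>"
  have w: "?w \<in> crossed_alg"
    by (intro single_crossed_alg one_GL2Q assms)
  note [simp] = w crossed_mult_alg pairing_add_left pairing_add_right crossed_mult_add_left crossed_mult_add_right
  have 1: "pairing (single \<alpha> i f \<odot> ?w) (single \<beta> j g) = pairing (single \<alpha> i f) (?w \<odot> single \<beta> j g)"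
    if \<alpha>: "\<alpha> \<in> GL2Q_pos" and f: "f \<in> modforms i" and \<beta>: "\<beta> \<in> GL2Q_pos" and g: "g \<in> modforms j"
    for \<alpha> \<beta> i j f g
  proof -
    have "f * slash k \<omega> (matrix_inv \<alpha>) * slash j g \<beta> = f * slash (k + j) (\<omega> * g) \<beta>"
      if "\<alpha> ** \<beta> = mat 1"
    proof -
      have "\<beta> = matrix_inv \<alpha>"
        using that mat_mult_eq_one_iff[OF \<alpha>] by simp
      then show ?thesis
        by (simp add: slash_mult mult.assoc)
    qed
    then show ?thesis
      by (simp add: crossed_mult_single pairing_single \<alpha> mat_inv_one slash_one add.assoc)
  qed
  have 2: "pairing (single \<alpha> i f \<odot> ?w) d = pairing (single \<alpha> i f) (?w \<odot> d)"
    if \<alpha>: "\<alpha> \<in> GL2Q_pos" and f: "f \<in> modforms i" for \<alpha> i f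
  proof (rule crossed_additive_eqI[of "\<lambda>d. pairing (single \<alpha> i f \<odot> ?w) d" "\<lambda>d. pairing (single \<alpha> i f) (?w \<odot> d)"])
    have s: "single \<alpha> i f \<in> crossed_alg"
      using \<alpha> f by (rule single_crossed_alg)
    show "crossed_additive (\<lambda>d. pairing (single \<alpha> i f \<odot> ?w) d)" "crossed_additive (\<lambda>d. pairing (single \<alpha> i f) (?w \<odot> d))"
      by (rule crossed_additiveI, simp add: s)+
  qed (use assms 1[OF \<alpha> f] in auto)
  show ?thesis
  proof (rule crossed_additive_eqI[of "\<lambda>b. pairing (b \<odot> ?w) d" "\<lambda>b. pairing b (?w \<odot> d)"])
    show "crossed_additive (\<lambda>b. pairing (b \<odot> ?w) d)" "crossed_additive (\<lambda>b. pairing b (?w \<odot> d))"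
      by (rule crossed_additiveI, simp add: assms)+
  qed (use assms 2 in auto)
qed

text \<open>This is \<open>b\<tau> = 0\<close>, reduced to homogeneous elements one argument at a time.\<close>

lemma pairing_cocycle:
  assumes "b \<in> crossed_alg" "c \<in> crossed_alg" "d \<in> crossed_alg"
  shows "pairing (b \<odot> c) d + twisted_sum (m - 2) (\<lambda>x. pairing (x \<odot> b) c) d = pairing b (c \<odot> d)"
proof -
  let ?L = "\<lambda>b c d. pairing (b \<odot> c) d + twisted_sum (m - 2) (\<lambda>x. pairing (x \<odot> b) c) d"
  let ?R = "\<lambda>b c d. pairing b (c \<odot> d)"
  note [simp] = crossed_mult_alg pairing_add_left pairing_add_right crossed_mult_add_left crossed_mult_add_right
  have add: "crossed_additive (\<lambda>x. pairing (x \<odot> b) c)" if "b \<in> crossed_alg" "c \<in> crossed_alg" for b c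
    by (rule crossed_additiveI) (simp add: that)
  have add3: "crossed_additive (\<lambda>d. ?L b c d)" "crossed_additive (\<lambda>d. ?R b c d)"
    if bc: "b \<in> crossed_alg" "c \<in> crossed_alg" for b c
  proof -
    have "twisted_sum (m - 2) (\<lambda>x. pairing (x \<odot> b) c) (x + y) = twisted_sum (m - 2) (\<lambda>x. pairing (x \<odot> b) c) x
        + twisted_sum (m - 2) (\<lambda>x. pairing (x \<odot> b) c) y" if "x \<in> crossed_alg" "y \<in> crossed_alg" for x y
      using twisted_sum_additive[OF add[OF bc]] that unfolding crossed_additive_def by blast
    then show "crossed_additive (\<lambda>d. ?L b c d)"
      by (intro crossed_additiveI) (simp add: bc algebra_simps)
    show "crossed_additive (\<lambda>d. ?R b c d)"
      by (intro crossed_additiveI) (simp add: bc)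
  qed
  have add2: "crossed_additive (\<lambda>c. ?L b c d)" "crossed_additive (\<lambda>c. ?R b c d)"
    if bd: "b \<in> crossed_alg" "d \<in> crossed_alg" for b d
  proof -
    have "twisted_sum (m - 2) (\<lambda>x. pairing (x \<odot> b) (c + c')) d = twisted_sum (m - 2) (\<lambda>x. pairing (x \<odot> b) c) d
        + twisted_sum (m - 2) (\<lambda>x. pairing (x \<odot> b) c') d" if "c \<in> crossed_alg" "c' \<in> crossed_alg" for c c'
      by (rule twisted_sum_add_fun) (simp_all add: bd that)
    then show "crossed_additive (\<lambda>c. ?L b c d)"
      by (intro crossed_additiveI) (simp add: bd algebra_simps)
    show "crossed_additive (\<lambda>c. ?R b c d)"
      by (intro crossed_additiveI) (simp add: bd)
  qed
  have add1: "crossed_additive (\<lambda>b. ?L b c d)" "crossed_additive (\<lambda>b. ?R b c d)"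
    if cd: "c \<in> crossed_alg" "d \<in> crossed_alg" for c d
  proof -
    have "twisted_sum (m - 2) (\<lambda>x. pairing (x \<odot> (b + b')) c) d = twisted_sum (m - 2) (\<lambda>x. pairing (x \<odot> b) c) d
        + twisted_sum (m - 2) (\<lambda>x. pairing (x \<odot> b') c) d" if "b \<in> crossed_alg" "b' \<in> crossed_alg" for b b'
      by (rule twisted_sum_add_fun) (simp_all add: cd that)
    then show "crossed_additive (\<lambda>b. ?L b c d)"
      by (intro crossed_additiveI) (simp add: cd algebra_simps)
    show "crossed_additive (\<lambda>b. ?R b c d)"
      by (intro crossed_additiveI) (simp add: cd)
  qed
  have 0: "?L (single \<alpha> i f) (single \<beta> j g) (single \<gamma> k h) = ?R (single \<alpha> i f) (single \<beta> j g) (single \<gamma> k h)"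
    if *: "\<alpha> \<in> GL2Q_pos" "\<beta> \<in> GL2Q_pos" "\<gamma> \<in> GL2Q_pos" "f \<in> modforms i" "g \<in> modforms j" "h \<in> modforms k"
    for \<alpha> \<beta> \<gamma> i j k f g h
  proof -
    have "pairing (0 \<odot> single \<alpha> i f) (single \<beta> j g) = 0"
      using crossed_additive_zero[OF add] * single_crossed_alg by blast
    then show ?thesis
      using pairing_cocycle_single[OF * refl refl refl] by (simp add: twisted_sum_single algebra_simps)
  qed
  have 1: "?L (single \<alpha> i f) (single \<beta> j g) d = ?R (single \<alpha> i f) (single \<beta> j g) d"
    if *: "\<alpha> \<in> GL2Q_pos" "\<beta> \<in> GL2Q_pos" "f \<in> modforms i" "g \<in> modforms j" for \<alpha> \<beta> i j f g
    by (rule crossed_additive_eqI[OF add3 assms(3)]) (use * 0 in \<open>auto intro: single_crossed_alg\<close>)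
  have 2: "?L (single \<alpha> i f) c d = ?R (single \<alpha> i f) c d"
    if *: "\<alpha> \<in> GL2Q_pos" "f \<in> modforms i" for \<alpha> i f
    by (rule crossed_additive_eqI[OF add2 assms(2)]) (use * 1 assms in \<open>auto intro: single_crossed_alg\<close>)
  show ?thesis
    by (rule crossed_additive_eqI[OF add1 assms(1)]) (use 2 assms in auto)
qed

end

lemma crossed_mult_assoc:
  assumes "a \<in> crossed_alg" "b \<in> crossed_alg" "c \<in> crossed_alg"
  shows "(a \<odot> b) \<odot> c = a \<odot> (b \<odot> c)"
proof -
  note add = crossed_mult_alg crossed_mult_add_left crossed_mult_add_right
  have 0: "(single \<alpha> i f \<odot> single \<beta> j g) \<odot> single \<gamma> k h = single \<alpha> i f \<odot> (single \<beta> j g \<odot> single \<gamma> k h)"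
    if "\<alpha> \<in> GL2Q_pos" "\<beta> \<in> GL2Q_pos" "\<gamma> \<in> GL2Q_pos" "h \<in> modforms k" for \<alpha> \<beta> \<gamma> i j k f g h
    using that
    by (simp add: crossed_mult_single slash_mult slash_slash inv_GL2Q mat_inv_mult modforms_off_H
        matrix_mul_assoc add.assoc mult.assoc)
  have 1: "(single \<alpha> i f \<odot> single \<beta> j g) \<odot> c = single \<alpha> i f \<odot> (single \<beta> j g \<odot> c)"
    if *: "\<alpha> \<in> GL2Q_pos" "\<beta> \<in> GL2Q_pos" "f \<in> modforms i" "g \<in> modforms j" for \<alpha> \<beta> i j f g
  proof -
    have [simp]: "single \<alpha> i f \<in> crossed_alg" "single \<beta> j g \<in> crossed_alg"
      using * by (auto intro: single_crossed_alg)
    show ?thesis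
      by (rule crossed_additive_eqI[of "\<lambda>c. (single \<alpha> i f \<odot> single \<beta> j g) \<odot> c"
          "\<lambda>c. single \<alpha> i f \<odot> (single \<beta> j g \<odot> c)"])
        (use assms * 0 in \<open>auto intro!: crossed_additiveI simp: add\<close>)
  qed
  have 2: "(single \<alpha> i f \<odot> b) \<odot> c = single \<alpha> i f \<odot> (b \<odot> c)"
    if *: "\<alpha> \<in> GL2Q_pos" "f \<in> modforms i" for \<alpha> i f
  proof -
    have [simp]: "single \<alpha> i f \<in> crossed_alg"
      using * by (auto intro: single_crossed_alg)
    show ?thesis
      by (rule crossed_additive_eqI[of "\<lambda>b. (single \<alpha> i f \<odot> b) \<odot> c" "\<lambda>b. single \<alpha> i f \<odot> (b \<odot> c)"])
        (use assms * 1 in \<open>auto intro!: crossed_additiveI simp: add\<close>)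
  qed
  show ?thesis
    by (rule crossed_additive_eqI[of "\<lambda>a. (a \<odot> b) \<odot> c" "\<lambda>a. a \<odot> (b \<odot> c)"])
      (use assms 2 in \<open>auto intro!: crossed_additiveI simp: add\<close>)
qed

lemma cochainsI:
  assumes hom: "\<And>as. as \<in> tuples n \<Longrightarrow> \<phi> as \<in> hom_polys r"
    and "\<And>as i x y. as \<in> tuples n \<Longrightarrow> i \<le> n \<Longrightarrow> x \<in> crossed_alg \<Longrightarrow> y \<in> crossed_alg \<Longrightarrow>
        \<phi> (as[i := x + y]) = \<phi> (as[i := x]) + \<phi> (as[i := y])"
    and "\<And>as i x c T1 T2. as \<in> tuples n \<Longrightarrow> i \<le> n \<Longrightarrow> x \<in> crossed_alg \<Longrightarrow>
        \<phi> (as[i := crossed_smult c x]) T1 T2 = c * \<phi> (as[i := x]) T1 T2"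
    and "\<And>as \<gamma>s. as \<in> tuples n \<Longrightarrow> length \<gamma>s = n + 1 \<Longrightarrow> set \<gamma>s \<subseteq> GL2Q_pos \<Longrightarrow>
        (\<And>i. i \<le> n \<Longrightarrow> crossed_supp (as ! i) \<subseteq> {\<gamma>s ! i}) \<Longrightarrow> foldr (**) \<gamma>s (mat 1) \<noteq> mat 1 \<Longrightarrow> \<phi> as = 0"
  shows "\<phi> \<in> cochains r n"
  unfolding cochains_def using assms by blast

context period_cocycle
begin

lemma tgv_cochain:
  assumes w: "w \<in> crossed_alg" "crossed_supp w \<subseteq> {mat 1}"
  shows "tgv pairing w \<in> cochains (m - 2) 1"
proof (rule cochainsI)
  note [simp] = w(1) crossed_mult_alg crossed_alg_add crossed_alg_smult
  fix as assume "as \<in> tuples 1"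
  then obtain a0 a1 where [simp]: "a0 \<in> crossed_alg" "a1 \<in> crossed_alg" and as: "as = [a0, a1]"
    using tuples_cases(2) by blast
  show "tgv pairing w as \<in> hom_polys (m - 2)"
    by (simp add: as tgv_def hom_polys_minus pairing_hom)
  show "tgv pairing w (as[i := x + y]) = tgv pairing w (as[i := x]) + tgv pairing w (as[i := y])"
    if "i \<le> 1" and [simp]: "x \<in> crossed_alg" "y \<in> crossed_alg" for i x y
  proof -
    have "i = 0 \<or> i = 1"
      using that(1) by arith
    then show ?thesis
      by (elim disjE) (simp_all add: as tgv_def pairing_add_left pairing_add_right crossed_mult_add_right)
  qed
  show "tgv pairing w (as[i := crossed_smult c x]) T1 T2 = c * tgv pairing w (as[i := x]) T1 T2"
    if "i \<le> 1" and [simp]: "x \<in> crossed_alg" for i x c T1 T2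
  proof -
    have "i = 0 \<or> i = 1"
      using that(1) by arith
    then show ?thesis
      by (elim disjE) (simp_all add: as tgv_def pairing_smult_left pairing_smult_right crossed_mult_smult_right)
  qed
  fix \<gamma>s assume \<gamma>s: "length \<gamma>s = 1 + 1" "set \<gamma>s \<subseteq> GL2Q_pos"
    "\<And>i. i \<le> 1 \<Longrightarrow> crossed_supp (as ! i) \<subseteq> {\<gamma>s ! i}" "foldr (**) \<gamma>s (mat 1) \<noteq> mat 1"
  obtain \<alpha> \<beta> where g: "\<gamma>s = [\<alpha>, \<beta>]"
    using \<gamma>s(1) by (auto simp: length_Suc_conv)
  have supp: "crossed_supp a0 \<subseteq> {\<alpha>}" "crossed_supp a1 \<subseteq> {\<beta>}"
    using \<gamma>s(3)[of 0] \<gamma>s(3)[of 1] by (simp_all add: g as)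
  have "pairing a0 (w \<odot> a1) = 0"
    using pairing_supp[OF supp(1) crossed_supp_mult[OF w(2) supp(2)]] \<gamma>s(4) by (simp add: g)
  then show "tgv pairing w as = 0"
    by (simp add: as tgv_def)
qed

lemma gv_expand:
  assumes "w \<in> crossed_alg" "a0 \<in> crossed_alg" "a1 \<in> crossed_alg" "a2 \<in> crossed_alg"
  shows "gv pairing w [a0, a1, a2] = pairing (a0 \<odot> (w \<odot> a1)) a2 - pairing (a0 \<odot> (a1 \<odot> w)) a2"
proof -
  have "gv pairing w [a0, a1, a2] = pairing (a0 \<odot> (w \<odot> a1 - a1 \<odot> w)) a2"
    by (simp add: gv_def)
  also have "a0 \<odot> (w \<odot> a1 - a1 \<odot> w) = a0 \<odot> (w \<odot> a1) - a0 \<odot> (a1 \<odot> w)"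
    by (intro crossed_mult_diff_right crossed_mult_alg assms)
  also have "pairing (a0 \<odot> (w \<odot> a1) - a0 \<odot> (a1 \<odot> w)) a2 = pairing (a0 \<odot> (w \<odot> a1)) a2 - pairing (a0 \<odot> (a1 \<odot> w)) a2"
    by (intro pairing_diff_left crossed_mult_alg assms)
  finally show ?thesis .
qed

lemma gv_cochain:
  assumes w: "w \<in> crossed_alg" "crossed_supp w \<subseteq> {mat 1}"
  shows "gv pairing w \<in> cochains (m - 2) 2"
proof (rule cochainsI)
  note [simp] = w(1) crossed_mult_alg crossed_alg_add crossed_alg_smult gv_expand
  fix as assume "as \<in> tuples 2"
  then obtain a0 a1 a2 where [simp]: "a0 \<in> crossed_alg" "a1 \<in> crossed_alg" "a2 \<in> crossed_alg"
    and as: "as = [a0, a1, a2]"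
    using tuples_cases(3) by blast
  show "gv pairing w as \<in> hom_polys (m - 2)"
    by (simp add: as hom_polys_diff pairing_hom)
  show "gv pairing w (as[i := x + y]) = gv pairing w (as[i := x]) + gv pairing w (as[i := y])"
    if "i \<le> 2" and [simp]: "x \<in> crossed_alg" "y \<in> crossed_alg" for i x y
  proof -
    have "i = 0 \<or> i = 1 \<or> i = 2"
      using that(1) by arith
    then show ?thesis
      by (elim disjE) (simp_all add: as pairing_add_left pairing_add_right crossed_mult_add_right crossed_mult_add_left
          numeral_2_eq_2 algebra_simps)
  qed
  show "gv pairing w (as[i := crossed_smult c x]) T1 T2 = c * gv pairing w (as[i := x]) T1 T2"
    if "i \<le> 2" and [simp]: "x \<in> crossed_alg" for i x c T1 T2
  proof -
    have "i = 0 \<or> i = 1 \<or> i = 2"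
      using that(1) by arith
    then show ?thesis
      by (elim disjE) (simp_all add: as pairing_smult_left pairing_smult_right crossed_mult_smult_right
          crossed_mult_smult_left numeral_2_eq_2 right_diff_distrib)
  qed
  fix \<gamma>s assume \<gamma>s: "length \<gamma>s = 2 + 1" "set \<gamma>s \<subseteq> GL2Q_pos"
    "\<And>i. i \<le> 2 \<Longrightarrow> crossed_supp (as ! i) \<subseteq> {\<gamma>s ! i}" "foldr (**) \<gamma>s (mat 1) \<noteq> mat 1"
  obtain \<alpha> \<beta> \<gamma> where g: "\<gamma>s = [\<alpha>, \<beta>, \<gamma>]"
    using \<gamma>s(1) by (auto simp: length_Suc_conv numeral_2_eq_2)
  have supp: "crossed_supp a0 \<subseteq> {\<alpha>}" "crossed_supp a1 \<subseteq> {\<beta>}" "crossed_supp a2 \<subseteq> {\<gamma>}"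
    using \<gamma>s(3)[of 0] \<gamma>s(3)[of 1] \<gamma>s(3)[of 2] by (simp_all add: g as)
  have supp': "crossed_supp (w \<odot> a1) \<subseteq> {\<beta>}" "crossed_supp (a1 \<odot> w) \<subseteq> {\<beta>}"
    using crossed_supp_mult[OF w(2) supp(2)] crossed_supp_mult[OF supp(2) w(2)] by simp_all
  have "\<alpha> ** \<beta> ** \<gamma> \<noteq> mat 1"
    using \<gamma>s(4) by (simp add: g matrix_mul_assoc)
  then have "pairing (a0 \<odot> (w \<odot> a1)) a2 = 0" "pairing (a0 \<odot> (a1 \<odot> w)) a2 = 0"
    using pairing_supp[OF crossed_supp_mult[OF supp(1) supp'(1)] supp(3)]
      pairing_supp[OF crossed_supp_mult[OF supp(1) supp'(2)] supp(3)] by auto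
  then show "gv pairing w as = 0"
    by (simp add: as)
qed

text \<open>The cocycle identity is applied to \<open>(a\<^sup>0, \<omega>a\<^sup>1, a\<^sup>2)\<close>, which accounts for two of the three terms of
the coboundary; the remaining term is, up to sign, \<open>\<tau>(a\<^sup>0a\<^sup>1\<omega>, a\<^sup>2)\<close> after moving \<open>\<omega>\<close>.\<close>

lemma gv_eq_coboundary:
  assumes "\<omega> \<in> modforms k" "as \<in> tuples 2"
  defines "w \<equiv> form_embed k \<omega>"
  shows "gv pairing w as = coch_b (m - 2) 1 (tgv pairing w) as"
proof -
  have w: "w \<in> crossed_alg"
    unfolding w_def form_embed_single by (intro single_crossed_alg one_GL2Q assms)
  obtain a0 a1 a2 where a: "a0 \<in> crossed_alg" "a1 \<in> crossed_alg" "a2 \<in> crossed_alg"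
    and as: "as = [a0, a1, a2]"
    using tuples_cases(3)[OF assms(2)] by blast
  note alg = w a crossed_mult_alg
  have tw: "twisted_sum (m - 2) (\<lambda>x. - pairing (x \<odot> a0) (w \<odot> a1)) a2
      = - twisted_sum (m - 2) (\<lambda>x. pairing (x \<odot> a0) (w \<odot> a1)) a2"
    by (simp add: twisted_sum_def poly_act_minus sum_negf)
  have "pairing (a0 \<odot> (w \<odot> a1)) a2 = pairing a0 (w \<odot> (a1 \<odot> a2))
      - twisted_sum (m - 2) (\<lambda>x. pairing (x \<odot> a0) (w \<odot> a1)) a2"
    using pairing_cocycle[of a0 "w \<odot> a1" a2] by (simp add: alg crossed_mult_assoc eq_diff_eq)
  moreover have "pairing (a0 \<odot> (a1 \<odot> w)) a2 = pairing (a0 \<odot> a1) (w \<odot> a2)"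
    using pairing_move_form[OF crossed_mult_alg[OF a(1,2)] a(3) assms(1)]
    by (simp add: alg crossed_mult_assoc form_embed_single[symmetric] w_def[symmetric])
  ultimately show ?thesis
    unfolding as coch_b_tgv gv_expand[OF w a] tw by simp
qed

text \<open>Each of the two values in \<open>B(tgv)\<close> pairs an element with one supported at \<open>1\<close>.\<close>

lemma coch_B_tgv_zero:
  assumes "w \<in> crossed_alg" "crossed_supp w \<subseteq> {mat 1}" "as \<in> tuples 0"
  shows "coch_B (m - 2) 1 (tgv pairing w) as = 0"
proof -
  obtain a where a: "a \<in> crossed_alg" "as = [a]"
    using tuples_cases(1)[OF assms(3)] by blast
  have one: "crossed_supp crossed_one \<subseteq> {mat 1}"
    unfolding crossed_one_def form_embed_single by (rule crossed_supp_single)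
  have "pairing crossed_one (w \<odot> a) = 0"
    by (intro pairing_supp_one crossed_one_alg crossed_mult_alg assms a disjI1 one)
  moreover have "crossed_supp (w \<odot> crossed_one) \<subseteq> {mat 1}"
    using crossed_supp_mult[OF assms(2) one] by simp
  then have "pairing a (w \<odot> crossed_one) = 0"
    by (intro pairing_supp_one crossed_one_alg crossed_mult_alg assms a disjI2)
  ultimately show ?thesis
    unfolding a(2) coch_B_tgv by simp
qed

end

theorem proposition11:
  fixes m :: nat and z0 :: complex and \<omega> :: "complex \<Rightarrow> complex"
    and \<tau> :: "crossed \<Rightarrow> crossed \<Rightarrow> bipoly"
  assumes "m \<ge> 2" and "Im z0 > 0"
    and "\<tau> = tau m z0 \<or> \<tau> = ttau m z0"
    and "\<omega> \<in> modforms m"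
  shows "gv \<tau> (form_embed m \<omega>) \<in> cochains (m - 2) 2
    \<and> tgv \<tau> (form_embed m \<omega>) \<in> cochains (m - 2) 1
    \<and> (\<forall>as\<in>tuples 2. gv \<tau> (form_embed m \<omega>) as
          = coch_b (m - 2) 1 (tgv \<tau> (form_embed m \<omega>)) as)
    \<and> (\<forall>as\<in>tuples 0. coch_B (m - 2) 1 (tgv \<tau> (form_embed m \<omega>)) as = 0)"
proof -
  obtain K where "period_cocycle m K" and \<tau>: "\<tau> = bilin_ext m K"
    using assms(3) period_cocycle_tau[OF assms(1,2)] period_cocycle_ttau[OF assms(1,2)]
    unfolding tau_def ttau_def by blast
  then interpret period_cocycle m K
    by blast
  have w: "form_embed m \<omega> \<in> crossed_alg" "crossed_supp (form_embed m \<omega>) \<subseteq> {mat 1}"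
    unfolding form_embed_single by (intro single_crossed_alg one_GL2Q assms(4), rule crossed_supp_single)
  show ?thesis
    unfolding \<tau> using gv_cochain[OF w] tgv_cochain[OF w] gv_eq_coboundary[OF assms(4)]
      coch_B_tgv_zero[OF w] by blast
qed

end
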